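(* Let $(M,\Omega)$ be a locally homogeneous multisymplectic manifold of degree $k$ and let $\alpha$ be a differential $p$-form on $M$, with $p=k-1$ or $p=k$, which is invariant under the locally Hamiltonian $(k-1)$-vector fields and under the locally Hamiltonian vector fields; that is, $L(X)\alpha=0$ for every locally Hamiltonian $(k-1)$-vector field $X$ on $M$ and $L(Z)\alpha=0$ for every locally Hamiltonian vector field $Z$ on $M$. Then: 1. If $p=k$, then $\alpha=c\,\Omega$ with $c\in\mathbb{R}$. 2. If $p=k-1$, then $\alpha=0$.
   Context: All manifolds are real, paracompact, connected and $C^\infty$; $\dim M=n$. A multisymplectic manifold of degree $k\ge 2$ is a pair $(M,\Omega)$ where $\Omega$ is a closed $k$-form on $M$ that is $1$-nondegenerate, i.e. for every $x\in M$ the map $T_xM\to\Lambda^{k-1}(T_x^*M)$, $v\mapsto i(v)\Omega_x$, is injective. An $m$-vector field is a smooth section of $\Lambda^m(TM)$; contraction is determined by $i(v_1\wedge\dots\wedge v_m)=i(v_1)\cdots i(v_m)$, and $L(X)=d\,i(X)-(-1)^m i(X)\,d$ for an $m$-vector field $X$. An $m$-vector field $X$ is locally Hamiltonian if $i(X)\Omega$ is closed. Local Euler-like vector field: let $x\in M$ and let $K$ be a compact set with $x$ in the interior of $K$. A local Euler-like vector field at $x$ with respect to $K$ is a vector field $\Delta^x$ on $M$ such that $\operatorname{supp}\Delta^x=\overline{\{y\in M: \Delta^x(y)\neq 0\}}\subset K$, and such that there is a diffeomorphism $\varphi$ from the interior of $\operatorname{supp}\Delta^x$ onto $\mathbb{R}^n$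 with $\varphi(x)=0$ and $\varphi_*\Delta^x=x^i\,\partial/\partial x^i$ (the standard dilation vector field on $\mathbb{R}^n$). Locally homogeneous: a differential form $\Omega$ on $M$ is locally homogeneous at $x\in M$ if for every open set $U$ containing $x$ there exist a compact set $K\subset U$ and a local Euler-like vector field $\Delta^x$ at $x$ with respect to $K$ such that $L(\Delta^x)\Omega=f\,\Omega$ on $U$ for some $f\in C^\infty(U)$. $\Omega$ is locally homogeneous if this holds at every $x\in M$. A locally homogeneous multisymplectic manifold is a multisymplectic manifold $(M,\Omega)$ with $\Omega$ locally homogeneous. *)

theory Defs
  imports "HOL-Analysis.Analysis"
begin

section \<open>Smooth manifolds\<close>

text \<open>The two notions below are only used for open \<open>S\<close>; there \<^term>\<open>frechet_derivative f (at x)\<close> depends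
  only on \<open>f\<close> restricted to \<open>S\<close>, so the values of \<open>f\<close> outside \<open>S\<close> are irrelevant.\<close>

primrec Ck_on :: "nat \<Rightarrow> 'a::euclidean_space set \<Rightarrow> ('a \<Rightarrow> 'b::real_normed_vector) \<Rightarrow> bool" where
  "Ck_on 0 S f \<longleftrightarrow> continuous_on S f"
| "Ck_on (Suc k) S f \<longleftrightarrow>
     (\<forall>x\<in>S. f differentiable (at x)) \<and> (\<forall>v. Ck_on k S (\<lambda>x. frechet_derivative f (at x) v))"

definition smooth_on :: "'a::euclidean_space set \<Rightarrow> ('a \<Rightarrow> 'b::real_normed_vector) \<Rightarrow> bool" where
  "smooth_on S f \<longleftrightarrow> (\<forall>k. Ck_on k S f)"

text \<open>The manifold is the whole type \<open>'m\<close> with its topology, modelled on \<open>'e\<close> (so \<open>n = DIM('e)\<close>);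
  its smooth structure is given by an atlas. The values of \<open>coord c\<close> outside \<open>cdom c\<close> are irrelevant.\<close>

datatype ('m, 'e) chart = Chart (cdom: "'m set") (coord: "'m \<Rightarrow> 'e")

abbreviation cimg :: "('m, 'e) chart \<Rightarrow> 'e set" where
  "cimg c \<equiv> coord c ` cdom c"

definition cinv :: "('m, 'e) chart \<Rightarrow> 'e \<Rightarrow> 'm" where
  "cinv c = inv_into (cdom c) (coord c)"

definition is_chart :: "('m::topological_space, 'e::euclidean_space) chart \<Rightarrow> bool" where
  "is_chart c \<longleftrightarrow> open (cdom c) \<and> open (cimg c) \<and> homeomorphism (cdom c) (cimg c) (coord c) (cinv c)"

definition smooth_atlas :: "('m::topological_space, 'e::euclidean_space) chart set \<Rightarrow> bool" where
  "smooth_atlas A \<longleftrightarrow>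
     (\<forall>c\<in>A. is_chart c) \<and> (\<Union>c\<in>A. cdom c) = UNIV \<and>
     (\<forall>c\<in>A. \<forall>c'\<in>A. smooth_on (coord c ` (cdom c \<inter> cdom c')) (coord c' \<circ> cinv c))"

definition paracompact_UNIV :: "'m::topological_space itself \<Rightarrow> bool" where
  "paracompact_UNIV _ \<longleftrightarrow>
     (\<forall>\<U>::'m set set. (\<forall>U\<in>\<U>. open U) \<and> \<Union>\<U> = UNIV \<longrightarrow>
        (\<exists>\<V>. (\<forall>V\<in>\<V>. open V \<and> (\<exists>U\<in>\<U>. V \<subseteq> U)) \<and> \<Union>\<V> = UNIV \<and>
             (\<forall>x. \<exists>N. open N \<and> x \<in> N \<and> finite {V \<in> \<V>. V \<inter> N \<noteq> {}})))"

definition manifold :: "('m::t2_space, 'e::euclidean_space) chart set \<Rightarrow> bool" where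
  "manifold A \<longleftrightarrow> smooth_atlas A \<and> paracompact_UNIV TYPE('m) \<and> connected (UNIV :: 'm set)"

definition smooth_fun ::
  "('m, 'e::euclidean_space) chart set \<Rightarrow> 'm set \<Rightarrow> ('m \<Rightarrow> 'b::real_normed_vector) \<Rightarrow> bool" where
  "smooth_fun A U f \<longleftrightarrow> (\<forall>c\<in>A. smooth_on (coord c ` (cdom c \<inter> U)) (f \<circ> cinv c))"

definition diffeo_onto_model ::
  "('m::topological_space, 'e::euclidean_space) chart set \<Rightarrow> 'm set \<Rightarrow> ('m \<Rightarrow> 'e) \<Rightarrow> bool" where
  "diffeo_onto_model A W \<phi> \<longleftrightarrow>
     bij_betw \<phi> W UNIV \<and> smooth_fun A W \<phi> \<and>
     continuous_on UNIV (inv_into W \<phi>) \<and>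
     (\<forall>c\<in>A. smooth_on (\<phi> ` (cdom c \<inter> W)) (coord c \<circ> inv_into W \<phi>))"

section \<open>Tangent vectors and vector fields\<close>

text \<open>For every point \<open>x\<close> a chart \<open>chart_at A x\<close> around \<open>x\<close> is fixed once and for all, and a tangent vector
  at \<open>x\<close> is given by its coordinate vector in that chart. Thus \<open>T\<^sub>x M\<close> is the type \<open>'e\<close>, and the components in
  any other chart around \<open>x\<close> are obtained by applying the derivative of the transition map.\<close>

definition chart_at :: "('m, 'e) chart set \<Rightarrow> 'm \<Rightarrow> ('m, 'e) chart" where
  "chart_at A x = (SOME c. c \<in> A \<and> x \<in> cdom c)"

definition tchange :: "('m, 'e::euclidean_space) chart \<Rightarrow> ('m, 'e) chart \<Rightarrow> 'm \<Rightarrow> 'e \<Rightarrow> 'e" where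
  "tchange c c' x = frechet_derivative (coord c' \<circ> cinv c) (at (coord c x))"

definition tdiff ::
  "('m, 'e::euclidean_space) chart set \<Rightarrow> ('m \<Rightarrow> 'b::real_normed_vector) \<Rightarrow> 'm \<Rightarrow> 'e \<Rightarrow> 'b" where
  "tdiff A f x = frechet_derivative (f \<circ> cinv (chart_at A x)) (at (coord (chart_at A x) x))"

definition vector_field :: "('m, 'e::euclidean_space) chart set \<Rightarrow> ('m \<Rightarrow> 'e) \<Rightarrow> bool" where
  "vector_field A Z \<longleftrightarrow>
     (\<forall>c\<in>A. smooth_on (cimg c) (\<lambda>u. let x = cinv c u in tchange (chart_at A x) c x (Z x)))"

section \<open>Differential forms\<close>

text \<open>A \<open>p\<close>-linear map takes the list of its arguments, and vanishes on lists of any other length.\<close>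

definition alt_form :: "nat \<Rightarrow> ('e::real_vector list \<Rightarrow> real) \<Rightarrow> bool" where
  "alt_form p \<omega> \<longleftrightarrow>
     (\<forall>vs. length vs \<noteq> p \<longrightarrow> \<omega> vs = 0) \<and>
     (\<forall>vs i. length vs = p \<and> i < p \<longrightarrow> linear (\<lambda>v. \<omega> (vs[i := v]))) \<and>
     (\<forall>vs i j. length vs = p \<and> i < j \<and> j < p \<and> vs ! i = vs ! j \<longrightarrow> \<omega> vs = 0)"

definition form_rep ::
  "('m, 'e::euclidean_space) chart set \<Rightarrow> ('m \<Rightarrow> 'e list \<Rightarrow> real) \<Rightarrow> ('m, 'e) chart \<Rightarrow> 'e \<Rightarrow> 'e list \<Rightarrow> real" where
  "form_rep A \<omega> c u vs = (let x = cinv c u in \<omega> x (map (tchange c (chart_at A x) x) vs))"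

definition diff_form ::
  "('m, 'e::euclidean_space) chart set \<Rightarrow> nat \<Rightarrow> ('m \<Rightarrow> 'e list \<Rightarrow> real) \<Rightarrow> bool" where
  "diff_form A p \<omega> \<longleftrightarrow>
     (\<forall>x. alt_form p (\<omega> x)) \<and> (\<forall>c\<in>A. \<forall>vs. smooth_on (cimg c) (\<lambda>u. form_rep A \<omega> c u vs))"

text \<open>The coordinate formula for the exterior derivative, taken at \<open>x\<close> in the chart \<open>chart_at A x\<close>. If \<open>\<omega>\<close> is a
  \<open>p\<close>-form, the result vanishes on lists of length other than \<open>p + 1\<close>.\<close>

definition ext_deriv ::
  "('m, 'e::euclidean_space) chart set \<Rightarrow> ('m \<Rightarrow> 'e list \<Rightarrow> real) \<Rightarrow> 'm \<Rightarrow> 'e list \<Rightarrow> real" where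
  "ext_deriv A \<omega> x vs =
     (\<Sum>i<length vs. (- 1) ^ i *
        frechet_derivative (\<lambda>u. form_rep A \<omega> (chart_at A x) u (take i vs @ drop (Suc i) vs))
          (at (coord (chart_at A x) x)) (vs ! i))"

definition closed_form ::
  "('m, 'e::euclidean_space) chart set \<Rightarrow> ('m \<Rightarrow> 'e list \<Rightarrow> real) \<Rightarrow> bool" where
  "closed_form A \<omega> \<longleftrightarrow> (\<forall>x vs. ext_deriv A \<omega> x vs = 0)"

definition interior_prod :: "'e \<Rightarrow> ('e list \<Rightarrow> real) \<Rightarrow> 'e list \<Rightarrow> real" where
  "interior_prod v \<omega> = (\<lambda>ws. \<omega> (v # ws))"

section \<open>Multivector fields\<close>

text \<open>\<open>\<Lambda>\<^sup>m(V)\<close> is realised in the dual of the space of alternating \<open>m\<close>-forms on \<open>V\<close>: the decomposable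
  \<open>v\<^sub>1 \<and> \<dots> \<and> v\<^sub>m\<close> is evaluation at \<open>(v\<^sub>1, \<dots>, v\<^sub>m)\<close>, and \<open>\<Lambda>\<^sup>m(V)\<close> is the span of the decomposables.
  Off the alternating \<open>m\<close>-forms these functionals are set to 0.\<close>

definition wedge :: "'e::real_vector list \<Rightarrow> ('e list \<Rightarrow> real) \<Rightarrow> real" where
  "wedge vs = (\<lambda>\<omega>. if alt_form (length vs) \<omega> then \<omega> vs else 0)"

definition multivector :: "nat \<Rightarrow> (('e::real_vector list \<Rightarrow> real) \<Rightarrow> real) \<Rightarrow> bool" where
  "multivector m X \<longleftrightarrow>
     (\<exists>(N::nat) (a :: nat \<Rightarrow> real) V. (\<forall>j<N. length (V j) = m) \<and> X = (\<lambda>\<omega>. \<Sum>j<N. a j * wedge (V j) \<omega>))"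

text \<open>Smoothness: in each chart the components \<open>\<langle>\<eta>, X\<rangle>\<close> against constant forms \<open>\<eta>\<close> are smooth.\<close>

definition multivector_field ::
  "('m, 'e::euclidean_space) chart set \<Rightarrow> nat \<Rightarrow> ('m \<Rightarrow> ('e list \<Rightarrow> real) \<Rightarrow> real) \<Rightarrow> bool" where
  "multivector_field A m X \<longleftrightarrow>
     (\<forall>x. multivector m (X x)) \<and>
     (\<forall>c\<in>A. \<forall>\<eta>. alt_form m \<eta> \<longrightarrow>
        smooth_on (cimg c) (\<lambda>u. let x = cinv c u in X x (\<lambda>vs. \<eta> (map (tchange (chart_at A x) c x) vs))))"

definition mv_of_vf :: "('m \<Rightarrow> 'e::real_vector) \<Rightarrow> 'm \<Rightarrow> ('e list \<Rightarrow> real) \<Rightarrow> real" where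
  "mv_of_vf Z x = wedge [Z x]"

text \<open>The contraction is the linear extension of \<open>i(v\<^sub>1 \<and> \<dots> \<and> v\<^sub>m) = i(v\<^sub>1) \<cdots> i(v\<^sub>m)\<close>, see \<open>contract_wedge\<close>
  below; this order of the factors is the reason for the list reversal.\<close>

definition contract :: "(('e list \<Rightarrow> real) \<Rightarrow> real) \<Rightarrow> ('e list \<Rightarrow> real) \<Rightarrow> 'e list \<Rightarrow> real" where
  "contract X \<omega> = (\<lambda>ws. X (\<lambda>vs. \<omega> (rev vs @ ws)))"

lemma foldr_interior_prod: "foldr interior_prod vs \<omega> ws = \<omega> (rev vs @ ws)"
  by (induction vs arbitrary: ws) (simp_all add: interior_prod_def)

lemma alt_form_contract_aux:
  assumes "alt_form p \<omega>" and p: "m + length ws = p"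
  shows "alt_form m (\<lambda>vs. \<omega> (rev vs @ ws))"
  unfolding alt_form_def
proof (intro conjI allI impI)
  fix vs :: "'a list" assume "length vs \<noteq> m"
  then show "\<omega> (rev vs @ ws) = 0" using assms by (auto simp: alt_form_def)
next
  fix vs :: "'a list" and i assume i: "length vs = m \<and> i < m"
  then have "rev (vs[i := v]) @ ws = (rev vs @ ws)[m - 1 - i := v]" for v
    by (auto simp: rev_update list_update_append)
  moreover have "linear (\<lambda>v. \<omega> ((rev vs @ ws)[m - 1 - i := v]))"
    using assms i by (auto simp: alt_form_def)
  ultimately show "linear (\<lambda>v. \<omega> (rev (vs[i := v]) @ ws))" by simp
next
  fix vs :: "'a list" and i j assume ij: "length vs = m \<and> i < j \<and> j < m \<and> vs ! i = vs ! j"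
  have "(rev vs @ ws) ! (m - 1 - j) = (rev vs @ ws) ! (m - 1 - i)"
    using ij by (auto simp: nth_append rev_nth Suc_diff_Suc)
  moreover have "m - 1 - j < m - 1 - i" "m - 1 - i < p" "length (rev vs @ ws) = p" using ij p by auto
  ultimately show "\<omega> (rev vs @ ws) = 0"
    using assms(1) unfolding alt_form_def by blast
qed

lemma contract_wedge:
  assumes "alt_form p \<omega>"
  shows "contract (wedge vs) \<omega> = foldr interior_prod vs \<omega>"
proof
  fix ws
  show "contract (wedge vs) \<omega> ws = foldr interior_prod vs \<omega> ws"
  proof (cases "length vs + length ws = p")
    case True
    then show ?thesis
      using alt_form_contract_aux[OF assms True]
      by (simp add: contract_def wedge_def foldr_interior_prod)
  next
    case False
    then have "\<omega> (rev vs @ ws) = 0" using assms by (auto simp: alt_form_def)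
    then show ?thesis by (simp add: contract_def wedge_def foldr_interior_prod)
  qed
qed

definition contract_field ::
  "('m \<Rightarrow> ('e list \<Rightarrow> real) \<Rightarrow> real) \<Rightarrow> ('m \<Rightarrow> 'e list \<Rightarrow> real) \<Rightarrow> 'm \<Rightarrow> 'e list \<Rightarrow> real" where
  "contract_field X \<omega> x = contract (X x) (\<omega> x)"

definition lie ::
  "('m, 'e::euclidean_space) chart set \<Rightarrow> nat \<Rightarrow> ('m \<Rightarrow> ('e list \<Rightarrow> real) \<Rightarrow> real) \<Rightarrow>
   ('m \<Rightarrow> 'e list \<Rightarrow> real) \<Rightarrow> 'm \<Rightarrow> 'e list \<Rightarrow> real" where
  "lie A m X \<omega> x vs =
     ext_deriv A (contract_field X \<omega>) x vs - (- 1) ^ m * contract_field X (ext_deriv A \<omega>) x vs"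

section \<open>Multisymplectic manifolds\<close>

definition multisymplectic ::
  "('m, 'e::euclidean_space) chart set \<Rightarrow> nat \<Rightarrow> ('m \<Rightarrow> 'e list \<Rightarrow> real) \<Rightarrow> bool" where
  "multisymplectic A k \<Omega> \<longleftrightarrow>
     2 \<le> k \<and> diff_form A k \<Omega> \<and> closed_form A \<Omega> \<and> (\<forall>x. inj (\<lambda>v. interior_prod v (\<Omega> x)))"

definition locally_hamiltonian ::
  "('m, 'e::euclidean_space) chart set \<Rightarrow> ('m \<Rightarrow> 'e list \<Rightarrow> real) \<Rightarrow> nat \<Rightarrow>
   ('m \<Rightarrow> ('e list \<Rightarrow> real) \<Rightarrow> real) \<Rightarrow> bool" where
  "locally_hamiltonian A \<Omega> m X \<longleftrightarrow> multivector_field A m X \<and> closed_form A (contract_field X \<Omega>)"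

definition locally_hamiltonian_vf ::
  "('m, 'e::euclidean_space) chart set \<Rightarrow> ('m \<Rightarrow> 'e list \<Rightarrow> real) \<Rightarrow> ('m \<Rightarrow> 'e) \<Rightarrow> bool" where
  "locally_hamiltonian_vf A \<Omega> Z \<longleftrightarrow>
     vector_field A Z \<and> closed_form A (\<lambda>x. interior_prod (Z x) (\<Omega> x))"

definition vf_support :: "('m::topological_space \<Rightarrow> 'e::zero) \<Rightarrow> 'm set" where
  "vf_support Z = closure {y. Z y \<noteq> 0}"

text \<open>The dilation field on the model space has value \<open>u\<close> at \<open>u\<close>; hence the right-hand side \<open>\<phi> y\<close>.\<close>

definition local_euler_like ::
  "('m::t2_space, 'e::euclidean_space) chart set \<Rightarrow> 'm \<Rightarrow> 'm set \<Rightarrow> ('m \<Rightarrow> 'e) \<Rightarrow> bool" where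
  "local_euler_like A x K \<Delta> \<longleftrightarrow>
     compact K \<and> x \<in> interior K \<and> vector_field A \<Delta> \<and> vf_support \<Delta> \<subseteq> K \<and>
     (\<exists>\<phi>. diffeo_onto_model A (interior (vf_support \<Delta>)) \<phi> \<and>
          x \<in> interior (vf_support \<Delta>) \<and> \<phi> x = 0 \<and>
          (\<forall>y\<in>interior (vf_support \<Delta>). tdiff A \<phi> y (\<Delta> y) = \<phi> y))"

definition locally_homogeneous_at ::
  "('m::t2_space, 'e::euclidean_space) chart set \<Rightarrow> ('m \<Rightarrow> 'e list \<Rightarrow> real) \<Rightarrow> 'm \<Rightarrow> bool" where
  "locally_homogeneous_at A \<Omega> x \<longleftrightarrow>
     (\<forall>U. open U \<and> x \<in> U \<longrightarrow>
        (\<exists>K \<Delta>. compact K \<and> K \<subseteq> U \<and> local_euler_like A x K \<Delta> \<and>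
           (\<exists>f::'m \<Rightarrow> real. smooth_fun A U f \<and>
              (\<forall>y\<in>U. \<forall>vs. lie A 1 (mv_of_vf \<Delta>) \<Omega> y vs = f y * \<Omega> y vs))))"

definition locally_homogeneous ::
  "('m::t2_space, 'e::euclidean_space) chart set \<Rightarrow> ('m \<Rightarrow> 'e list \<Rightarrow> real) \<Rightarrow> bool" where
  "locally_homogeneous A \<Omega> \<longleftrightarrow> (\<forall>x. locally_homogeneous_at A \<Omega> x)"

end

theory Submission
  imports Defs
begin

text \<open>
  Write \<open>k = m + 1\<close>. The invariance is tested at one point \<open>x\<close> at a time, on locally Hamiltonian
  \<open>m\<close>-vector fields supported in a chart around \<open>x\<close>; it yields first an algebraic condition on the value of \<open>\<alpha>\<close> at
  \<open>x\<close> and then a condition on its first derivative.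

  \<^bold>\<open>Test fields.\<close> Nondegeneracy of \<open>\<Omega>\<close> says that \<open>v \<mapsto> i(v)\<Omega>\<close> is injective; dually, contraction
  \<open>X \<mapsto> i(X)\<Omega>\<close> maps \<open>m\<close>-vectors onto covectors. Hence for every \<open>m\<close>-vector \<open>X\<^sub>0\<close> at \<open>x\<close> there are
  an \<open>m\<close>-vector field \<open>X\<close> and a function \<open>G\<close>, both with compact support in a chart, such that
  \<open>i(X)\<Omega> = dG\<close>, \<open>G(x) = 0\<close> and \<open>X(x) = X\<^sub>0\<close> (\<open>hamiltonian_multivector_coefficients\<close>). Both \<open>X\<close> and \<open>GX\<close> are
  locally Hamiltonian, since \<open>i(GX)\<Omega> = d(G\<^sup>2/2)\<close>.

  \<^bold>\<open>The algebraic condition.\<close> At \<open>x\<close> the field \<open>GX\<close> vanishes, so \<open>L(GX)\<alpha> = 0\<close> reduces there to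
  \<open>dG \<and> i(X\<^sub>0)\<alpha> = 0\<close>, that is \<open>i(X\<^sub>0)\<Omega> \<and> i(X\<^sub>0)\<alpha> = 0\<close> for all \<open>X\<^sub>0\<close> (\<open>invariance_pointwise\<close>).
  If \<open>\<alpha>\<close> has degree \<open>m\<close>, then \<open>i(X\<^sub>0)\<alpha>\<close> is a number that vanishes whenever \<open>i(X\<^sub>0)\<Omega> \<noteq> 0\<close>, and
  such \<open>X\<^sub>0\<close> span, so \<open>\<alpha> = 0\<close> (\<open>alt_form_eq_0_of_product\<close>). If \<open>\<alpha>\<close> has degree \<open>k\<close>, then the covectors
  \<open>i(X\<^sub>0)\<alpha>\<close> and \<open>i(X\<^sub>0)\<Omega>\<close> are always parallel, and polarising this in \<open>X\<^sub>0\<close> gives \<open>\<alpha> = h\<Omega>\<close> for a function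
  \<open>h\<close> (\<open>alt_form_proportional\<close>).

  \<^bold>\<open>The factor is constant.\<close> Insert \<open>\<alpha> = h\<Omega>\<close> into \<open>L(X)\<alpha> = d(h dG) - (-1)\<^sup>m i(X)(dh \<and> \<Omega>)\<close>. The term
  \<open>dh \<and> dG\<close> cancels against part of the second summand, and what remains is the contraction of \<open>\<Omega>\<close> with the
  \<open>(m - 1)\<close>-vector obtained by contracting \<open>dh\<close> into \<open>X\<close>. For \<open>X\<^sub>0\<close> decomposable with first factor \<open>e\<close>,
  evaluation on \<open>w, e\<close> leaves \<open>dh(e) \<Omega>(\<dots>, w, e)\<close> with arbitrary remaining arguments. So \<open>dh(e) \<noteq> 0\<close> would put
  \<open>e\<close> into the kernel of \<open>\<Omega>\<close>; hence \<open>dh = 0\<close> (\<open>invariant_multiple_derivative_0\<close>), and \<open>h\<close> is constant because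
  the manifold is connected.
\<close>

section \<open>Calculus of smooth maps\<close>

lemma Ck_on_cong:
  assumes "open S" and "\<And>x. x \<in> S \<Longrightarrow> f x = g x" and "Ck_on k S f"
  shows "Ck_on k S g"
  using assms(2,3)
proof (induction k arbitrary: f g)
  case 0
  then show ?case by (simp cong: continuous_on_cong)
next
  case (Suc k)
  have D: "(g has_derivative frechet_derivative f (at x)) (at x)" if "x \<in> S" for x
    by (rule has_derivative_transform_within_open[of f _ x UNIV S])
      (use Suc.prems that \<open>open S\<close> in \<open>auto simp: frechet_derivative_works\<close>)
  have eq: "frechet_derivative f (at x) v = frechet_derivative g (at x) v" if "x \<in> S" for x v
    using frechet_derivative_at[OF D[OF that]] by simp
  have "Ck_on k S (\<lambda>x. frechet_derivative g (at x) v)" for v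
    by (rule Suc.IH[of "\<lambda>x. frechet_derivative f (at x) v"]) (use Suc.prems eq in auto)
  then show ?case using D by (auto simp: differentiable_def)
qed

text \<open>The usual way to establish \<^const>\<open>Ck_on\<close>: any explicit candidate for the derivative may be used in place of
  \<^const>\<open>frechet_derivative\<close>.\<close>

lemma Ck_on_SucI:
  assumes "open S" and D: "\<And>x. x \<in> S \<Longrightarrow> (f has_derivative f' x) (at x)"
    and "\<And>v. Ck_on k S (\<lambda>x. f' x v)"
  shows "Ck_on (Suc k) S f"
proof -
  have "Ck_on k S (\<lambda>x. frechet_derivative f (at x) v)" for v
    by (rule Ck_on_cong[OF assms(1) _ assms(3)[of v]]) (simp add: frechet_derivative_at[OF D, symmetric])
  then show ?thesis using D by (auto simp: differentiable_def)
qed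

lemma Ck_on_Suc_has_derivative:
  "Ck_on (Suc k) S f \<Longrightarrow> x \<in> S \<Longrightarrow> (f has_derivative frechet_derivative f (at x)) (at x)"
  by (simp add: frechet_derivative_works)

lemma Ck_on_Suc_imp: "Ck_on (Suc k) S f \<Longrightarrow> Ck_on k S f"
proof (induction k arbitrary: f)
  case 0
  then show ?case
    by (auto intro!: continuous_at_imp_continuous_on differentiable_imp_continuous_within)
next
  case (Suc k)
  then show ?case by (metis Ck_on.simps(2))
qed

lemma Ck_on_imp_continuous_on: "Ck_on k S f \<Longrightarrow> continuous_on S f"
  by (induction k) (auto simp del: Ck_on.simps(2) dest: Ck_on_Suc_imp)

lemma Ck_on_subset: "Ck_on k S f \<Longrightarrow> T \<subseteq> S \<Longrightarrow> Ck_on k T f"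
  by (induction k arbitrary: f) (auto intro: continuous_on_subset)

lemma Ck_on_local:
  assumes "\<And>x. x \<in> S \<Longrightarrow> \<exists>T. open T \<and> x \<in> T \<and> Ck_on k T f"
  shows "Ck_on k S f"
  using assms
proof (induction k arbitrary: f)
  case 0
  show ?case
    unfolding Ck_on.simps
  proof (rule continuous_at_imp_continuous_on, rule ballI)
    fix x assume "x \<in> S"
    then obtain T where "open T" "x \<in> T" "continuous_on T f" using "0.prems" by auto
    then show "isCont f x" by (simp add: continuous_on_eq_continuous_at)
  qed
next
  case (Suc k)
  have "f differentiable at x" if "x \<in> S" for x
    using Suc.prems[OF that] by auto
  moreover have "Ck_on k S (\<lambda>x. frechet_derivative f (at x) v)" for v
  proof (rule Suc.IH)
    fix x assume "x \<in> S"
    then show "\<exists>T. open T \<and> x \<in> T \<and> Ck_on k T (\<lambda>x. frechet_derivative f (at x) v)"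
      using Suc.prems by fastforce
  qed
  ultimately show ?case by simp
qed

lemma Ck_on_const: "Ck_on k S (\<lambda>x. c)"
  by (induction k arbitrary: c) simp_all

lemma Ck_on_bounded_linear:
  assumes "bounded_linear f" "open S"
  shows "Ck_on k S f"
proof (cases k)
  case 0
  then show ?thesis using assms by (simp add: linear_continuous_on)
next
  case (Suc n)
  then show ?thesis
    using Ck_on_SucI[OF assms(2), of f "\<lambda>_. f" n] assms(1)
    by (simp add: Ck_on_const bounded_linear_imp_has_derivative)
qed

lemma Ck_on_add:
  assumes "open S" "Ck_on k S f" "Ck_on k S g"
  shows "Ck_on k S (\<lambda>x. f x + g x)"
  using assms(2,3)
proof (induction k arbitrary: f g)
  case 0
  then show ?case by (auto intro: continuous_on_add)
next
  case (Suc k)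
  show ?case
  proof (rule Ck_on_SucI[OF assms(1)])
    show "((\<lambda>x. f x + g x) has_derivative
        (\<lambda>v. frechet_derivative f (at x) v + frechet_derivative g (at x) v)) (at x)" if "x \<in> S" for x
      by (intro has_derivative_add Ck_on_Suc_has_derivative[OF _ that]) (fact Suc.prems)+
    show "Ck_on k S (\<lambda>x. frechet_derivative f (at x) v + frechet_derivative g (at x) v)" for v
      by (rule Suc.IH) (use Suc.prems in auto)
  qed
qed

lemma Ck_on_bounded_bilinear:
  assumes "bounded_bilinear h" "open S" "Ck_on k S f" "Ck_on k S g"
  shows "Ck_on k S (\<lambda>x. h (f x) (g x))"
  using assms(3,4)
proof (induction k arbitrary: f g)
  case 0
  then show ?case by (auto intro: bounded_bilinear.continuous_on[OF assms(1)])
next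
  case (Suc k)
  show ?case
  proof (rule Ck_on_SucI[OF assms(2)])
    show "((\<lambda>x. h (f x) (g x)) has_derivative
        (\<lambda>v. h (f x) (frechet_derivative g (at x) v) + h (frechet_derivative f (at x) v) (g x))) (at x)"
      if "x \<in> S" for x
      by (intro bounded_bilinear.FDERIV[OF assms(1)] Ck_on_Suc_has_derivative[OF _ that]) (fact Suc.prems)+
    show "Ck_on k S (\<lambda>x. h (f x) (frechet_derivative g (at x) v) + h (frechet_derivative f (at x) v) (g x))" for v
      by (intro Ck_on_add assms(2) Suc.IH Ck_on_Suc_imp[OF Suc.prems(1)] Ck_on_Suc_imp[OF Suc.prems(2)])
        (use Suc.prems in auto)
  qed
qed

lemmas Ck_on_scaleR = Ck_on_bounded_bilinear[OF bounded_bilinear_scaleR]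
lemmas Ck_on_mult = Ck_on_bounded_bilinear[OF bounded_bilinear_mult]
lemmas Ck_on_inner = Ck_on_bounded_bilinear[OF bounded_bilinear_inner]

lemma Ck_on_diff:
  assumes "open S" "Ck_on k S f" "Ck_on k S g"
  shows "Ck_on k S (\<lambda>x. f x - g x)"
  using Ck_on_add[OF assms(1,2) Ck_on_scaleR[OF assms(1) Ck_on_const[of k S "-1"] assms(3)]] by simp

lemma Ck_on_sum:
  assumes "open S" "finite I" "\<And>i. i \<in> I \<Longrightarrow> Ck_on k S (f i)"
  shows "Ck_on k S (\<lambda>x. \<Sum>i\<in>I. f i x)"
  using assms(2,3) by (induction I) (auto simp: Ck_on_const intro: Ck_on_add[OF assms(1)])

lemma linear_euclidean_sum:
  fixes v :: "'a::euclidean_space"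
  assumes "linear f"
  shows "f v = (\<Sum>b\<in>Basis. (v \<bullet> b) *\<^sub>R f b)"
proof -
  have "f v = f (\<Sum>b\<in>Basis. (v \<bullet> b) *\<^sub>R b)" by (simp add: euclidean_representation)
  then show ?thesis by (simp add: linear_sum[OF assms] linear_cmul[OF assms])
qed

text \<open>Induction does not apply directly to the chain rule \<open>D(f \<circ> g)(x) v = Df(g x)(Dg(x) v)\<close>, because the direction
  \<open>Dg(x) v\<close> varies with \<open>x\<close>; expanding it in an orthonormal basis turns the right-hand side into a sum of products.\<close>

lemma Ck_on_compose:
  fixes f :: "'b::euclidean_space \<Rightarrow> 'c::real_normed_vector" and g :: "'a::euclidean_space \<Rightarrow> 'b"
  assumes "open S" "open T" "g ` S \<subseteq> T" "Ck_on k S g" "Ck_on k T f"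
  shows "Ck_on k S (\<lambda>x. f (g x))"
  using assms(4,5)
proof (induction k arbitrary: f)
  case 0
  then show ?case using assms(3) by (auto intro: continuous_on_compose2)
next
  case (Suc k)
  show ?case
  proof (rule Ck_on_SucI[OF assms(1)])
    fix x assume x: "x \<in> S"
    then have Df: "(f has_derivative frechet_derivative f (at (g x))) (at (g x))"
      using assms(3) Suc.prems(2) by (auto simp: frechet_derivative_works)
    show "((\<lambda>x. f (g x)) has_derivative
        (\<lambda>v. \<Sum>b\<in>Basis. (frechet_derivative g (at x) v \<bullet> b) *\<^sub>R frechet_derivative f (at (g x)) b)) (at x)"
      using has_derivative_compose[OF Ck_on_Suc_has_derivative[OF Suc.prems(1) x] Df]
      by (subst (asm) linear_euclidean_sum[OF has_derivative_linear[OF Df]])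
  next
    fix v
    have "Ck_on k S (\<lambda>x. frechet_derivative g (at x) v \<bullet> b)" for b
      using Suc.prems(1) by (intro Ck_on_inner[OF assms(1)] Ck_on_const) auto
    moreover have "Ck_on k S (\<lambda>x. frechet_derivative f (at (g x)) b)" for b
      by (rule Suc.IH[OF Ck_on_Suc_imp[OF Suc.prems(1)]]) (use Suc.prems in auto)
    ultimately show "Ck_on k S (\<lambda>x. \<Sum>b\<in>Basis.
        (frechet_derivative g (at x) v \<bullet> b) *\<^sub>R frechet_derivative f (at (g x)) b)"
      by (intro Ck_on_sum Ck_on_scaleR assms(1)) auto
  qed
qed

lemma smooth_on_cong: "open S \<Longrightarrow> (\<And>x. x \<in> S \<Longrightarrow> f x = g x) \<Longrightarrow> smooth_on S f \<Longrightarrow> smooth_on S g"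
  unfolding smooth_on_def using Ck_on_cong[of S f g] by blast

lemma smooth_on_subset: "smooth_on S f \<Longrightarrow> T \<subseteq> S \<Longrightarrow> smooth_on T f"
  unfolding smooth_on_def by (blast intro: Ck_on_subset)

lemma smooth_on_local:
  "(\<And>x. x \<in> S \<Longrightarrow> \<exists>T. open T \<and> x \<in> T \<and> smooth_on T f) \<Longrightarrow> smooth_on S f"
  unfolding smooth_on_def by (meson Ck_on_local)

lemma smooth_on_const [intro]: "smooth_on S (\<lambda>x. c)"
  by (simp add: smooth_on_def Ck_on_const)

lemma smooth_on_bounded_linear: "bounded_linear f \<Longrightarrow> open S \<Longrightarrow> smooth_on S f"
  by (simp add: smooth_on_def Ck_on_bounded_linear)

lemma smooth_on_ident: "open S \<Longrightarrow> smooth_on S (\<lambda>x. x)"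
  by (simp add: smooth_on_bounded_linear bounded_linear_ident)

lemma smooth_on_add: "open S \<Longrightarrow> smooth_on S f \<Longrightarrow> smooth_on S g \<Longrightarrow> smooth_on S (\<lambda>x. f x + g x)"
  by (simp add: smooth_on_def Ck_on_add)

lemma smooth_on_diff: "open S \<Longrightarrow> smooth_on S f \<Longrightarrow> smooth_on S g \<Longrightarrow> smooth_on S (\<lambda>x. f x - g x)"
  by (simp add: smooth_on_def Ck_on_diff)

lemma smooth_on_scaleR: "open S \<Longrightarrow> smooth_on S f \<Longrightarrow> smooth_on S g \<Longrightarrow> smooth_on S (\<lambda>x. f x *\<^sub>R g x)"
  by (simp add: smooth_on_def Ck_on_scaleR)

lemma smooth_on_mult:
  fixes f g :: "'a::euclidean_space \<Rightarrow> real"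
  shows "open S \<Longrightarrow> smooth_on S f \<Longrightarrow> smooth_on S g \<Longrightarrow> smooth_on S (\<lambda>x. f x * g x)"
  by (simp add: smooth_on_def Ck_on_mult)

lemma smooth_on_inner: "open S \<Longrightarrow> smooth_on S f \<Longrightarrow> smooth_on S g \<Longrightarrow> smooth_on S (\<lambda>x. f x \<bullet> g x)"
  by (simp add: smooth_on_def Ck_on_inner)

lemma smooth_on_sum:
  "open S \<Longrightarrow> finite I \<Longrightarrow> (\<And>i. i \<in> I \<Longrightarrow> smooth_on S (f i)) \<Longrightarrow> smooth_on S (\<lambda>x. \<Sum>i\<in>I. f i x)"
  by (simp add: smooth_on_def Ck_on_sum)

lemma smooth_on_compose:
  fixes f :: "'b::euclidean_space \<Rightarrow> 'c::real_normed_vector" and g :: "'a::euclidean_space \<Rightarrow> 'b"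
  assumes "open S" "open T" "g ` S \<subseteq> T" "smooth_on S g" "smooth_on T f"
  shows "smooth_on S (\<lambda>x. f (g x))"
  using assms by (simp add: smooth_on_def Ck_on_compose[OF assms(1-3)])

lemma smooth_on_frechet_derivative:
  "smooth_on S f \<Longrightarrow> smooth_on S (\<lambda>x. frechet_derivative f (at x) v)"
  unfolding smooth_on_def using Ck_on.simps(2) by blast

lemma smooth_on_has_derivative:
  "smooth_on S f \<Longrightarrow> x \<in> S \<Longrightarrow> (f has_derivative frechet_derivative f (at x)) (at x)"
  unfolding smooth_on_def by (blast intro: Ck_on_Suc_has_derivative)

lemma smooth_on_continuous_on: "smooth_on S f \<Longrightarrow> continuous_on S f"
  unfolding smooth_on_def by (blast intro: Ck_on_imp_continuous_on)

text \<open>Two applications of the mean value theorem express the second difference of \<open>g\<close> over a parallelogram with sides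
  \<open>e v\<close> and \<open>e w\<close> as \<open>e\<^sup>2\<close> times a mixed derivative at some point of the parallelogram, in either order of
  differentiation. For small \<open>e\<close> continuity of the mixed derivatives forces the two orders to agree at the corner.\<close>

lemma second_derivative_symmetric:
  fixes g :: "'a::euclidean_space \<Rightarrow> real"
  assumes "open S" "smooth_on S g" "x \<in> S"
  shows "frechet_derivative (\<lambda>y. frechet_derivative g (at y) v) (at x) w =
         frechet_derivative (\<lambda>y. frechet_derivative g (at y) w) (at x) v"
proof -
  define H where "H v w y = frechet_derivative (\<lambda>y. frechet_derivative g (at y) v) (at y) w" for v w y
  have H_cont: "continuous_on S (H v w)" for v w
    unfolding H_def
    by (intro smooth_on_continuous_on smooth_on_frechet_derivative assms)
  have mvt: "\<exists>y. (\<exists>s t. 0 \<le> s \<and> s \<le> e \<and> 0 \<le> t \<and> t \<le> e \<and> y = x + s *\<^sub>R v + t *\<^sub>R w) \<and>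
      g (x + e *\<^sub>R v + e *\<^sub>R w) - g (x + e *\<^sub>R v) - g (x + e *\<^sub>R w) + g x = e * (e * H v w y)"
    if e: "e > 0" and sub: "\<And>s t. 0 \<le> s \<Longrightarrow> s \<le> e \<Longrightarrow> 0 \<le> t \<Longrightarrow> t \<le> e \<Longrightarrow> x + s *\<^sub>R v + t *\<^sub>R w \<in> S"
    for e v w
  proof -
    define f where "f s = g (x + s *\<^sub>R v + e *\<^sub>R w) - g (x + s *\<^sub>R v)" for s
    have f: "(f has_real_derivative frechet_derivative g (at (x + s *\<^sub>R v + e *\<^sub>R w)) v
        - frechet_derivative g (at (x + s *\<^sub>R v)) v) (at s)" if "0 \<le> s" "s \<le> e" for s
    proof -
      have "((\<lambda>s. g (x + s *\<^sub>R v + t *\<^sub>R w)) has_derivative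
          (\<lambda>h. frechet_derivative g (at (x + s *\<^sub>R v + t *\<^sub>R w)) (h *\<^sub>R v))) (at s)" if "0 \<le> t" "t \<le> e" for t
        by (rule has_derivative_compose[of "\<lambda>s. x + s *\<^sub>R v + t *\<^sub>R w" "\<lambda>h. h *\<^sub>R v"])
          (auto intro!: derivative_eq_intros smooth_on_has_derivative[OF assms(2)] sub
            simp: \<open>0 \<le> s\<close> \<open>s \<le> e\<close> that)
      from this[of e] this[of 0] e
      have "(f has_derivative (\<lambda>h. frechet_derivative g (at (x + s *\<^sub>R v + e *\<^sub>R w)) (h *\<^sub>R v) -
          frechet_derivative g (at (x + s *\<^sub>R v)) (h *\<^sub>R v))) (at s)"
        unfolding f_def by (auto intro: has_derivative_diff)
      moreover have "linear (frechet_derivative g (at (x + s *\<^sub>R v + t *\<^sub>R w)))" if "0 \<le> t" "t \<le> e" for t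
        by (rule has_derivative_linear[OF smooth_on_has_derivative[OF assms(2)]])
          (simp add: sub \<open>0 \<le> s\<close> \<open>s \<le> e\<close> that)
      from this[of e] this[of 0] e
      have "frechet_derivative g (at (x + s *\<^sub>R v + e *\<^sub>R w)) (h *\<^sub>R v) -
          frechet_derivative g (at (x + s *\<^sub>R v)) (h *\<^sub>R v) =
          (frechet_derivative g (at (x + s *\<^sub>R v + e *\<^sub>R w)) v
        - frechet_derivative g (at (x + s *\<^sub>R v)) v) * h" for h
        by (simp add: linear_cmul algebra_simps)
      ultimately show ?thesis by (simp add: has_field_derivative_def)
    qed
    obtain s where s: "0 < s" "s < e" and fs: "f e - f 0 = e * (frechet_derivative g (at (x + s *\<^sub>R v + e *\<^sub>R w)) v
        - frechet_derivative g (at (x + s *\<^sub>R v)) v)"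
      using MVT2[OF e, of f, OF f] by auto
    define k where "k t = frechet_derivative g (at (x + s *\<^sub>R v + t *\<^sub>R w)) v" for t
    have k: "(k has_real_derivative H v w (x + s *\<^sub>R v + t *\<^sub>R w)) (at t)" if t: "0 \<le> t" "t \<le> e" for t
    proof -
      have D: "((\<lambda>y. frechet_derivative g (at y) v) has_derivative (\<lambda>h. H v h (x + s *\<^sub>R v + t *\<^sub>R w)))
          (at (x + s *\<^sub>R v + t *\<^sub>R w))"
        unfolding H_def using smooth_on_has_derivative[OF smooth_on_frechet_derivative[OF assms(2)]] sub s t
        by simp
      have "(k has_derivative (\<lambda>h. H v (h *\<^sub>R w) (x + s *\<^sub>R v + t *\<^sub>R w))) (at t)"
        unfolding k_def
        by (rule has_derivative_compose[of "\<lambda>t. x + s *\<^sub>R v + t *\<^sub>R w" "\<lambda>h. h *\<^sub>R w", OF _ D])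
          (auto intro!: derivative_eq_intros)
      then show ?thesis
        using linear_cmul[OF has_derivative_linear[OF D]] by (simp add: has_field_derivative_def mult_commute_abs)
    qed
    obtain t where t: "0 < t" "t < e" and kt: "k e - k 0 = e * H v w (x + s *\<^sub>R v + t *\<^sub>R w)"
      using MVT2[OF e, of k, OF k] by auto
    have "f e - f 0 = e * (e * H v w (x + s *\<^sub>R v + t *\<^sub>R w))"
      using fs kt by (simp add: k_def)
    then show ?thesis
      using s t unfolding f_def by (intro exI[of _ "x + s *\<^sub>R v + t *\<^sub>R w"] conjI exI[of _ s] exI[of _ t]) auto
  qed
  have close: "\<exists>e>0. \<forall>s t. 0 \<le> s \<longrightarrow> s \<le> e \<longrightarrow> 0 \<le> t \<longrightarrow> t \<le> e \<longrightarrow> x + s *\<^sub>R v + t *\<^sub>R w \<in> S \<and>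
      \<bar>H a b (x + s *\<^sub>R v + t *\<^sub>R w) - H a b x\<bar> < d"
    if d: "d > 0" for d v w a b
  proof -
    obtain r where r: "r > 0" "ball x r \<subseteq> S" using assms by (meson openE)
    from H_cont[of a b] \<open>x \<in> S\<close> d obtain r' where r': "r' > 0"
      "\<And>y. y \<in> S \<Longrightarrow> dist y x < r' \<Longrightarrow> dist (H a b y) (H a b x) < d"
      by (force simp: continuous_on_iff)
    define e where "e = min r r' / (2 * (norm v + norm w + 1))"
    have pos: "norm v + norm w + 1 > 0" by (simp add: add_nonneg_pos)
    have e: "e > 0" unfolding e_def using r r' pos by auto
    have "dist (x + s *\<^sub>R v + t *\<^sub>R w) x < min r r'" if "0 \<le> s" "s \<le> e" "0 \<le> t" "t \<le> e" for s t
    proof -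
      have "dist (x + s *\<^sub>R v + t *\<^sub>R w) x = norm (s *\<^sub>R v + t *\<^sub>R w)" by (simp add: dist_norm)
      also have "\<dots> \<le> s * norm v + t * norm w"
        using norm_triangle_ineq[of "s *\<^sub>R v" "t *\<^sub>R w"] that by simp
      also have "\<dots> \<le> e * norm v + e * norm w"
        using that by (intro add_mono mult_right_mono) auto
      also have "\<dots> \<le> e * (norm v + norm w + 1)" using e by (simp add: algebra_simps)
      also have "\<dots> = min r r' / 2" unfolding e_def using pos by (simp add: field_simps)
      also have "\<dots> < min r r'" using r r' by auto
      finally show ?thesis .
    qed
    then have "x + s *\<^sub>R v + t *\<^sub>R w \<in> S \<and> \<bar>H a b (x + s *\<^sub>R v + t *\<^sub>R w) - H a b x\<bar> < d"
      if "0 \<le> s" "s \<le> e" "0 \<le> t" "t \<le> e" for s t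
      using r(2) r'(2)[of "x + s *\<^sub>R v + t *\<^sub>R w"] that
      by (auto simp: dist_real_def dist_commute subset_eq)
    then show ?thesis using e by blast
  qed
  have "\<bar>H v w x - H w v x\<bar> < 2 * d" if d: "d > 0" for d
  proof -
    from close[OF d, of v w v w] obtain e1 where e1: "e1 > 0" "\<And>s t. 0 \<le> s \<Longrightarrow> s \<le> e1 \<Longrightarrow> 0 \<le> t \<Longrightarrow> t \<le> e1 \<Longrightarrow>
      x + s *\<^sub>R v + t *\<^sub>R w \<in> S \<and> \<bar>H v w (x + s *\<^sub>R v + t *\<^sub>R w) - H v w x\<bar> < d" by blast
    from close[OF d, of w v w v] obtain e2 where e2: "e2 > 0" "\<And>s t. 0 \<le> s \<Longrightarrow> s \<le> e2 \<Longrightarrow> 0 \<le> t \<Longrightarrow> t \<le> e2 \<Longrightarrow>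
      x + s *\<^sub>R w + t *\<^sub>R v \<in> S \<and> \<bar>H w v (x + s *\<^sub>R w + t *\<^sub>R v) - H w v x\<bar> < d" by blast
    \<comment> \<open>one \<open>e\<close> for both orders of differentiation, so that the second differences coincide\<close>
    define e where "e = min e1 e2"
    have e: "e > 0" "e \<le> e1" "e \<le> e2" using e1 e2 by (auto simp: e_def)
    have "\<exists>y. (\<exists>s t. 0 \<le> s \<and> s \<le> e \<and> 0 \<le> t \<and> t \<le> e \<and> y = x + s *\<^sub>R v + t *\<^sub>R w) \<and>
      g (x + e *\<^sub>R v + e *\<^sub>R w) - g (x + e *\<^sub>R v) - g (x + e *\<^sub>R w) + g x = e * (e * H v w y)"
      by (rule mvt[OF e(1)]) (meson e1(2) e(2) order_trans)
    then obtain y1 where y1: "\<bar>H v w y1 - H v w x\<bar> < d"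
      "g (x + e *\<^sub>R v + e *\<^sub>R w) - g (x + e *\<^sub>R v) - g (x + e *\<^sub>R w) + g x = e * (e * H v w y1)"
      using e1(2) e(2) by (metis order_trans)
    have "\<exists>y. (\<exists>s t. 0 \<le> s \<and> s \<le> e \<and> 0 \<le> t \<and> t \<le> e \<and> y = x + s *\<^sub>R w + t *\<^sub>R v) \<and>
      g (x + e *\<^sub>R w + e *\<^sub>R v) - g (x + e *\<^sub>R w) - g (x + e *\<^sub>R v) + g x = e * (e * H w v y)"
      by (rule mvt[OF e(1)]) (meson e2(2) e(3) order_trans)
    then obtain y2 where y2: "\<bar>H w v y2 - H w v x\<bar> < d"
      "g (x + e *\<^sub>R w + e *\<^sub>R v) - g (x + e *\<^sub>R w) - g (x + e *\<^sub>R v) + g x = e * (e * H w v y2)"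
      using e2(2) e(3) by (metis order_trans)
    have "x + e *\<^sub>R w + e *\<^sub>R v = x + e *\<^sub>R v + e *\<^sub>R w" by simp
    from y1(2) y2(2)[unfolded this] have "e * (e * H v w y1) = e * (e * H w v y2)" by linarith
    then have "H v w y1 = H w v y2" using e by simp
    then show ?thesis using y1 y2 by linarith
  qed
  from this[of "\<bar>H v w x - H w v x\<bar> / 2"] show ?thesis
    unfolding H_def by (cases "H v w x = H w v x") (auto simp: H_def)
qed

section \<open>Bump functions\<close>

text \<open>For \<open>m = 0\<close> this is the standard function that is smooth and flat at \<open>0\<close>. The derivative of a member of
  the family is a linear combination of members, so all of them are smooth by a single induction.\<close>

definition flat :: "nat \<Rightarrow> real \<Rightarrow> real" where
  "flat m t = (if t > 0 then inverse t ^ m * exp (- inverse t) else 0)"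

lemma flat_tendsto_0: "(flat m \<longlongrightarrow> 0) (at 0)"
proof -
  have "((\<lambda>t::real. inverse t ^ m / exp (inverse t)) \<longlongrightarrow> 0) (at_right 0)"
    by (rule filterlim_compose[OF tendsto_power_div_exp_0 filterlim_inverse_at_top_right])
  moreover have "\<forall>\<^sub>F t in at_right 0. inverse t ^ m / exp (inverse t) = flat m t"
    by (auto simp: eventually_at flat_def exp_minus divide_inverse intro!: exI[of _ 1])
  ultimately have "(flat m \<longlongrightarrow> 0) (at_right 0)"
    by (rule Lim_transform_eventually)
  moreover have "(flat m \<longlongrightarrow> 0) (at_left 0)"
    by (rule tendsto_eventually) (auto simp: eventually_at flat_def intro!: exI[of _ 1])
  ultimately show ?thesis by (simp add: filterlim_split_at)
qed

lemma flat_has_derivative: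
  "(flat m has_real_derivative flat (m + 2) t - real m * flat (m + 1) t) (at t)"
proof (cases t "0::real" rule: linorder_cases)
  case less
  have "((\<lambda>_. 0) has_real_derivative 0) (at t)" by simp
  then have "(flat m has_real_derivative 0) (at t)"
    by (rule has_field_derivative_transform_within_open[of _ _ _ "{..<0}"]) (use less in \<open>auto simp: flat_def\<close>)
  then show ?thesis using less by (simp add: flat_def)
next
  case equal
  have "((\<lambda>h. (flat m h - flat m 0) / (h - 0)) \<longlongrightarrow> 0) (at 0)"
    by (rule Lim_transform_eventually[OF flat_tendsto_0[of "m + 1"]])
      (auto simp: eventually_at flat_def divide_inverse intro!: exI[of _ 1])
  then show ?thesis using equal by (simp add: has_field_derivative_iff flat_def)
next
  case greater
  have "((\<lambda>t. inverse t ^ m * exp (- inverse t)) has_real_derivative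
      flat (m + 2) t - real m * flat (m + 1) t) (at t)"
  proof (rule DERIV_cong)
    show "((\<lambda>t. inverse t ^ m * exp (- inverse t)) has_real_derivative
        (inverse t ^ m * (exp (- inverse t) * inverse t ^ 2) - real m * inverse t ^ (m - 1) * inverse t ^ 2 * exp (- inverse t))) (at t)"
      using greater by (auto intro!: derivative_eq_intros simp: power2_eq_square)
    show "inverse t ^ m * (exp (- inverse t) * inverse t ^ 2) - real m * inverse t ^ (m - 1) * inverse t ^ 2 * exp (- inverse t)
        = flat (m + 2) t - real m * flat (m + 1) t"
      using greater by (cases m) (simp_all add: flat_def power2_eq_square algebra_simps)
  qed
  then show ?thesis
    by (rule has_field_derivative_transform_within_open[of _ _ _ "{0<..}"]) (use greater in \<open>auto simp: flat_def\<close>)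
qed

lemma smooth_flat: "smooth_on UNIV (flat m)"
proof -
  have "Ck_on k UNIV (flat m)" for k
  proof (induction k arbitrary: m)
    case 0
    show ?case
      by (auto intro!: continuous_at_imp_continuous_on DERIV_isCont flat_has_derivative)
  next
    case (Suc k)
    show ?case
    proof (rule Ck_on_SucI)
      show "(flat m has_derivative (\<lambda>h. (flat (m + 2) t - real m * flat (m + 1) t) * h)) (at t)" for t
        using flat_has_derivative by (simp add: has_field_derivative_def)
      show "Ck_on k UNIV (\<lambda>t. (flat (m + 2) t - real m * flat (m + 1) t) * h)" for h
        by (intro Ck_on_mult Ck_on_diff Ck_on_const Suc.IH open_UNIV)
    qed simp
  qed
  then show ?thesis by (simp add: smooth_on_def)
qed

text \<open>The witness is \<open>exp(r\<^sup>-\<^sup>2) flat\<^sub>0(r\<^sup>2 - \<bar>u - u0\<bar>\<^sup>2)\<close>, which is supported in the closed ball of radius \<open>r\<close>.\<close>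

lemma smooth_bump:
  fixes u0 :: "'a::euclidean_space"
  assumes "open U" "u0 \<in> U"
  obtains \<psi> :: "'a \<Rightarrow> real" and B where "compact B" "B \<subseteq> U" "smooth_on UNIV \<psi>" "\<psi> u0 = 1"
    "\<And>u. u \<notin> B \<Longrightarrow> \<psi> u = 0"
proof -
  obtain r where r: "r > 0" "cball u0 r \<subseteq> U" using assms open_contains_cball by blast
  define \<psi> where "\<psi> u = exp (inverse (r\<^sup>2)) * flat 0 (r\<^sup>2 - (u - u0) \<bullet> (u - u0))" for u :: 'a
  have inner: "smooth_on UNIV (\<lambda>u. r\<^sup>2 - (u - u0) \<bullet> (u - u0))"
    by (intro smooth_on_diff smooth_on_inner smooth_on_ident smooth_on_const open_UNIV)
  have "smooth_on UNIV (\<lambda>u. flat 0 (r\<^sup>2 - (u - u0) \<bullet> (u - u0)))"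
    by (rule smooth_on_compose[of _ UNIV, OF _ _ _ inner smooth_flat]) auto
  then have "smooth_on UNIV \<psi>"
    unfolding \<psi>_def by (intro smooth_on_mult smooth_on_const open_UNIV)
  moreover have "\<psi> u0 = 1"
    using r by (simp add: \<psi>_def flat_def exp_minus)
  moreover have "\<psi> u = 0" if "u \<notin> cball u0 r" for u
  proof -
    have "r < norm (u - u0)"
      using that by (simp add: dist_norm norm_minus_commute)
    from power_strict_mono[OF this, of 2] r(1) have "r\<^sup>2 < (norm (u - u0))\<^sup>2"
      by simp
    then have "\<not> 0 < r\<^sup>2 - (u - u0) \<bullet> (u - u0)"
      by (simp add: power2_norm_eq_inner)
    then show ?thesis by (simp only: \<psi>_def flat_def if_False mult_zero_right)
  qed
  ultimately show thesis by (intro that[of "cball u0 r" \<psi>] compact_cball r)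
qed

section \<open>Smooth dependence of solutions of linear equations\<close>

text \<open>At a zero of the second factor the product rule needs only continuity of the first. This is what allows a
  solution \<open>w\<close> of a linear system to be differentiated when so far only its continuity is known.\<close>

lemma has_derivative_scaleR_vanishing:
  fixes f :: "'a::real_normed_vector \<Rightarrow> real" and g :: "'a \<Rightarrow> 'b::real_normed_vector"
  assumes f: "isCont f x" and g: "(g has_derivative g') (at x)" and "g x = 0"
  shows "((\<lambda>y. f y *\<^sub>R g y) has_derivative (\<lambda>h. f x *\<^sub>R g' h)) (at x)"
proof -
  have lim: "((\<lambda>y. (1 / norm (y - x)) *\<^sub>R (g y - (g x + g' (y - x)))) \<longlongrightarrow> 0) (at x)"
    using g unfolding has_derivative_within by simp
  interpret g': bounded_linear g' by (rule has_derivative_bounded_linear[OF g])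
  obtain K where K: "\<And>h. norm (g' h) \<le> norm h * K" using g'.bounded by blast
  have f0: "((\<lambda>y. f y - f x) \<longlongrightarrow> 0) (at x)" using f by (simp add: isCont_def LIM_zero)
  have "((\<lambda>y. (f y - f x) *\<^sub>R ((1 / norm (y - x)) *\<^sub>R g' (y - x))) \<longlongrightarrow> 0) (at x)"
  proof (rule tendsto_0_le[OF f0, where K = K])
    show "\<forall>\<^sub>F y in at x. norm ((f y - f x) *\<^sub>R (1 / norm (y - x)) *\<^sub>R g' (y - x)) \<le> norm (f y - f x) * K"
    proof (rule always_eventually, rule allI)
      fix y
      have "(1 / norm (y - x)) * norm (g' (y - x)) \<le> K" if "y \<noteq> x"
        using K[of "y - x"] that by (simp add: field_simps)
      then show "norm ((f y - f x) *\<^sub>R (1 / norm (y - x)) *\<^sub>R g' (y - x)) \<le> norm (f y - f x) * K"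
        using mult_left_mono[of "norm (g' (y - x)) / norm (y - x)" K "\<bar>f y - f x\<bar>"]
        by (cases "y = x") (auto simp: field_simps)
    qed
  qed
  with tendsto_scaleR[OF f[unfolded isCont_def] lim]
  have "((\<lambda>y. f y *\<^sub>R ((1 / norm (y - x)) *\<^sub>R (g y - (g x + g' (y - x)))) +
      (f y - f x) *\<^sub>R ((1 / norm (y - x)) *\<^sub>R g' (y - x))) \<longlongrightarrow> 0) (at x)"
    by (auto intro: tendsto_eq_intros)
  moreover have "f y *\<^sub>R ((1 / norm (y - x)) *\<^sub>R (g y - (g x + g' (y - x)))) +
      (f y - f x) *\<^sub>R ((1 / norm (y - x)) *\<^sub>R g' (y - x)) =
      (1 / norm (y - x)) *\<^sub>R (f y *\<^sub>R g y - (f x *\<^sub>R g x + f x *\<^sub>R g' (y - x)))" for y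
    by (simp add: \<open>g x = 0\<close> diff_divide_distrib scaleR_diff_right scaleR_diff_left)
  ultimately show ?thesis
    unfolding has_derivative_within
    by (simp add: bounded_linear_const_scaleR g'.bounded_linear_axioms)
qed

text \<open>Let \<open>R u\<close> be the inverse of \<open>S u\<close>. Near a fixed \<open>u\<close>, the solution \<open>w y = R y (h y)\<close> satisfies
  \<open>w y = R u (h y - (S y - S u)(w y))\<close>. Since \<open>S y - S u\<close> is small, this gives continuity of \<open>w\<close> at \<open>u\<close>, and
  since it vanishes at \<open>y = u\<close>, it then gives differentiability with
  \<open>Dw = R u (Dh - (DS)(w u))\<close>. The derivative is again a solution of the same system, with a right-hand side that
  is as smooth as \<open>Dh\<close> and \<open>w\<close>; hence one gains one derivative at a time.\<close>

lemma smooth_on_linear_solution: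
  fixes S :: "'a::euclidean_space \<Rightarrow> 'a \<Rightarrow> 'a"
  assumes U: "open U" and lin: "\<And>u. u \<in> U \<Longrightarrow> linear (S u)" and inj: "\<And>u. u \<in> U \<Longrightarrow> inj (S u)"
    and S: "\<And>v. smooth_on U (\<lambda>u. S u v)" and h: "smooth_on U h"
  obtains w where "smooth_on U w" "\<And>u. u \<in> U \<Longrightarrow> S u (w u) = h u"
proof -
  define R where "R u = inv (S u)" for u
  have SR: "S u (R u v) = v" if "u \<in> U" for u v
    unfolding R_def
    by (rule surj_f_inv_f[OF linear_injective_imp_surjective[OF lin[OF that] inj[OF that] refl]])
  have RS: "R u (S u v) = v" if "u \<in> U" for u v
    unfolding R_def by (rule inv_f_f[OF inj[OF that]])
  have linR: "linear (R u)" if "u \<in> U" for u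
  proof (rule linearI)
    fix v w r
    have "R u (S u (R u v + R u w)) = R u (v + w)" "R u (S u (r *\<^sub>R R u v)) = R u (r *\<^sub>R v)"
      by (simp_all add: linear_add[OF lin[OF that]] linear_cmul[OF lin[OF that]] SR[OF that])
    then show "R u (v + w) = R u v + R u w" "R u (r *\<^sub>R v) = r *\<^sub>R R u v"
      by (simp_all add: RS[OF that])
  qed

  have expand: "S u v = (\<Sum>b\<in>Basis. (v \<bullet> b) *\<^sub>R S u b)" if "u \<in> U" for u v
    by (rule linear_euclidean_sum[OF lin[OF that]])
  have S': "((\<lambda>u. S u v) has_derivative frechet_derivative (\<lambda>u. S u v) (at u)) (at u)" if "u \<in> U" for u v
    by (rule smooth_on_has_derivative[OF S that])
  have main: "isCont (\<lambda>u. R u (h u)) u \<and> (\<forall>h'. (h has_derivative h') (at u) \<longrightarrow>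
      ((\<lambda>u. R u (h u)) has_derivative (\<lambda>v. R u (h' v -
        (\<Sum>b\<in>Basis. (R u (h u) \<bullet> b) *\<^sub>R frechet_derivative (\<lambda>u. S u b) (at u) v)))) (at u))"
    if u: "u \<in> U" and h: "isCont h u" for u h
  proof -
    define w where "w y = R y (h y)" for y
    define E where "E y v = S y v - S u v" for y v
    have R: "bounded_linear (R u)" using linR[OF u] by (rule linear_conv_bounded_linear[THEN iffD1])
    obtain K where K: "K > 0" "\<And>v. norm (R u v) \<le> norm v * K"
      using bounded_linear.pos_bounded[OF R] by blast
    have E: "((\<lambda>y. E y v) has_derivative frechet_derivative (\<lambda>u. S u v) (at u)) (at u)" for v
      unfolding E_def using has_derivative_diff[OF S'[OF u] has_derivative_const] by simp
    have E0: "((\<lambda>y. E y v) \<longlongrightarrow> 0) (at u)" for v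
      using has_derivative_continuous[OF E, of v] by (simp add: isCont_def E_def)
    have Esum: "E y v = (\<Sum>b\<in>Basis. (v \<bullet> b) *\<^sub>R E y b)" if "y \<in> U" for y v
      unfolding E_def by (subst expand[OF that], subst expand[OF u]) (simp add: algebra_simps sum_subtractf)
    define \<epsilon> where "\<epsilon> y = (\<Sum>b\<in>Basis. norm (E y b))" for y
    have \<epsilon>: "(\<epsilon> \<longlongrightarrow> 0) (at u)" unfolding \<epsilon>_def
      by (rule tendsto_null_sum) (simp add: E0 tendsto_norm_zero)
    have Ebound: "norm (E y v) \<le> norm v * \<epsilon> y" if "y \<in> U" for y v
    proof -
      have "norm (E y v) \<le> (\<Sum>b\<in>Basis. norm ((v \<bullet> b) *\<^sub>R E y b))"
        unfolding Esum[OF that, of v] by (rule norm_sum)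
      also have "\<dots> \<le> (\<Sum>b\<in>Basis. norm v * norm (E y b))"
        by (rule sum_mono) (auto intro!: mult_right_mono Basis_le_norm)
      finally show ?thesis by (simp add: \<epsilon>_def sum_distrib_left)
    qed
    have inU: "\<forall>\<^sub>F y in at u. y \<in> U" using U u by (rule eventually_at_in_open')
    have w_eq: "w y = R u (h y - E y (w y))" if "y \<in> U" for y
    proof -
      have "S u (w y) = h y - E y (w y)" unfolding E_def w_def by (simp add: SR[OF that])
      then show ?thesis using RS[OF u, of "w y"] by simp
    qed
    have wu: "w u = R u (h u)" by (simp add: w_def)
    have hc: "((\<lambda>y. h y - h u) \<longlongrightarrow> 0) (at u)"
      using h by (simp add: isCont_def LIM_zero)
    have "((\<lambda>y. w y - w u) \<longlongrightarrow> 0) (at u)"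
    proof (rule Lim_null_comparison)
      show "((\<lambda>y. (norm (h y - h u) + norm (w u) * \<epsilon> y) * (2 * K)) \<longlongrightarrow> 0) (at u)"
        by (rule tendsto_eq_intros tendsto_norm_zero[OF hc] \<epsilon> refl)+ simp
      have "\<forall>\<^sub>F y in at u. dist (\<epsilon> y) 0 < 1 / (2 * K)"
        using tendstoD[OF \<epsilon>, of "1 / (2 * K)"] K by simp
      then show "\<forall>\<^sub>F y in at u. norm (w y - w u) \<le> (norm (h y - h u) + norm (w u) * \<epsilon> y) * (2 * K)"
        using inU
      proof eventually_elim
        case (elim y)
        have "w y - w u = R u (h y - h u - E y (w u) - E y (w y - w u))"
        proof -
          have "E y (w y) = E y (w u) + E y (w y - w u)"
            unfolding E_def using linear_diff[OF lin] u elim by (simp add: algebra_simps)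
          then show ?thesis
            using w_eq[OF elim(2)] by (simp add: wu diff_diff_eq linear_diff[OF linR[OF u]] linear_add[OF linR[OF u]])
        qed
        then have "norm (w y - w u) \<le> norm (h y - h u - E y (w u) - E y (w y - w u)) * K"
          using K by metis
        also have "\<dots> \<le> (norm (h y - h u) + norm (w u) * \<epsilon> y + norm (w y - w u) * \<epsilon> y) * K"
        proof (rule mult_right_mono)
          have "norm (h y - h u - E y (w u) - E y (w y - w u)) \<le>
              norm (h y - h u) + norm (E y (w u)) + norm (E y (w y - w u))"
            by (meson add_right_mono norm_triangle_ineq4 order_trans)
          then show "norm (h y - h u - E y (w u) - E y (w y - w u)) \<le>
              norm (h y - h u) + norm (w u) * \<epsilon> y + norm (w y - w u) * \<epsilon> y"
            using Ebound[OF elim(2), of "w u"] Ebound[OF elim(2), of "w y - w u"] by linarith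
        qed (use K in simp)
        finally have 1: "norm (w y - w u) \<le>
            (norm (h y - h u) + norm (w u) * \<epsilon> y) * K + norm (w y - w u) * (\<epsilon> y * K)"
          by (simp add: algebra_simps)
        have "\<epsilon> y < 1 / (2 * K)" using elim(1) by (simp add: dist_real_def)
        then have "\<epsilon> y * K \<le> 1 / 2" using K(1) by (simp add: field_simps)
        then have "norm (w y - w u) * (\<epsilon> y * K) \<le> norm (w y - w u) * (1 / 2)"
          by (rule mult_left_mono) simp
        with 1 show ?case by (simp add: algebra_simps)
      qed
    qed
    then have w_cont: "isCont w u" by (simp add: isCont_def LIM_zero_iff)
    have "((\<lambda>y. \<Sum>b\<in>Basis. (w y \<bullet> b) *\<^sub>R E y b) has_derivative
        (\<lambda>v. \<Sum>b\<in>Basis. (w u \<bullet> b) *\<^sub>R frechet_derivative (\<lambda>u. S u b) (at u) v)) (at u)"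
      by (intro has_derivative_sum has_derivative_scaleR_vanishing E isCont_inner w_cont)
        (auto simp: E_def)
    then have "((\<lambda>y. R u (h y - (\<Sum>b\<in>Basis. (w y \<bullet> b) *\<^sub>R E y b))) has_derivative
        (\<lambda>v. R u (h' v - (\<Sum>b\<in>Basis. (w u \<bullet> b) *\<^sub>R frechet_derivative (\<lambda>u. S u b) (at u) v)))) (at u)"
      if "(h has_derivative h') (at u)" for h'
      by (intro bounded_linear.has_derivative[OF R] has_derivative_diff that)
    then have "(w has_derivative
        (\<lambda>v. R u (h' v - (\<Sum>b\<in>Basis. (w u \<bullet> b) *\<^sub>R frechet_derivative (\<lambda>u. S u b) (at u) v)))) (at u)"
      if "(h has_derivative h') (at u)" for h'
      by (rule has_derivative_transform_within_open[OF _ U u]) (use that w_eq Esum in \<open>metis\<close>)+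
    with w_cont show ?thesis by (simp add: w_def[abs_def])
  qed
  have "Ck_on k U (\<lambda>u. R u (h u))" if "Ck_on k U h" for k h
    using that
  proof (induction k arbitrary: h)
    case 0
    then show ?case
      using main by (simp add: continuous_on_eq_continuous_at[OF U])
  next
    case (Suc k)
    show ?case
    proof (rule Ck_on_SucI[OF U])
      fix u assume u: "u \<in> U"
      then have "(h has_derivative frechet_derivative h (at u)) (at u)"
        by (rule Ck_on_Suc_has_derivative[OF Suc.prems])
      then show "((\<lambda>u. R u (h u)) has_derivative (\<lambda>v. R u (frechet_derivative h (at u) v -
        (\<Sum>b\<in>Basis. (R u (h u) \<bullet> b) *\<^sub>R frechet_derivative (\<lambda>u. S u b) (at u) v)))) (at u)"
        using main[OF u has_derivative_continuous] by blast
    next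
      show "Ck_on k U (\<lambda>u. R u (frechet_derivative h (at u) v -
        (\<Sum>b\<in>Basis. (R u (h u) \<bullet> b) *\<^sub>R frechet_derivative (\<lambda>u. S u b) (at u) v)))" for v
      proof (intro Suc.IH Ck_on_diff U Ck_on_sum Ck_on_scaleR Ck_on_inner Ck_on_const finite_Basis)
        show "Ck_on k U (\<lambda>u. frechet_derivative h (at u) v)" using Suc.prems by simp
        show "Ck_on k U h" by (rule Ck_on_Suc_imp[OF Suc.prems])
        show "Ck_on k U (\<lambda>u. frechet_derivative (\<lambda>u. S u b) (at u) v)" for b
          using smooth_on_frechet_derivative[OF S] by (simp add: smooth_on_def)
      qed
    qed
  qed
  then have "smooth_on U (\<lambda>u. R u (h u))" using h by (simp add: smooth_on_def)
  then show thesis by (rule that) (simp add: SR)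
qed

section \<open>Alternating forms\<close>

lemma alt_form_length: "alt_form p \<omega> \<Longrightarrow> length vs \<noteq> p \<Longrightarrow> \<omega> vs = 0"
  by (simp add: alt_form_def)

lemma alt_form_linear:
  assumes "alt_form p \<omega>" shows "linear (\<lambda>v. \<omega> (xs @ v # ys))"
proof (cases "length (xs @ 0 # ys) = p")
  case True
  then have "linear (\<lambda>v. \<omega> ((xs @ 0 # ys)[length xs := v]))"
    using assms unfolding alt_form_def by (metis add_Suc_right length_Cons length_append less_add_Suc1)
  then show ?thesis by simp
next
  case False
  then show ?thesis by (simp add: alt_form_length[OF assms] linear_zero)
qed

lemma alt_form_repeat:
  assumes "alt_form p \<omega>" shows "\<omega> (xs @ a # ys @ a # zs) = 0"
proof (cases "length (xs @ a # ys @ a # zs) = p")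
  case True
  then show ?thesis
    using assms[unfolded alt_form_def, THEN conjunct2, THEN conjunct2, rule_format,
        of "xs @ a # ys @ a # zs" "length xs" "Suc (length xs + length ys)"]
    by (simp add: nth_append)
next
  case False
  then show ?thesis by (simp add: alt_form_length[OF assms])
qed

lemma alt_form_swap:
  assumes "alt_form p \<omega>" shows "\<omega> (xs @ a # ys @ b # zs) = - \<omega> (xs @ b # ys @ a # zs)"
proof -
  have "\<omega> (xs @ (a + b) # ys @ (a + b) # zs) =
      \<omega> (xs @ a # ys @ a # zs) + \<omega> (xs @ b # ys @ a # zs) +
      (\<omega> (xs @ a # ys @ b # zs) + \<omega> (xs @ b # ys @ b # zs))"
    using linear_add[OF alt_form_linear[OF assms, of xs "ys @ (a + b) # zs"]]
      linear_add[OF alt_form_linear[OF assms, of "xs @ a # ys" zs]]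
      linear_add[OF alt_form_linear[OF assms, of "xs @ b # ys" zs]] by simp
  then show ?thesis by (simp add: alt_form_repeat[OF assms])
qed

lemma alt_form_move:
  assumes "alt_form p \<omega>" shows "\<omega> (xs @ a # ys @ zs) = (- 1) ^ length ys * \<omega> (xs @ ys @ a # zs)"
proof (induction ys arbitrary: xs)
  case (Cons b ys)
  show ?case using alt_form_swap[OF assms, of xs a "[]" b "ys @ zs"] Cons[of "xs @ [b]"] by simp
qed simp

text \<open>Applied to \<open>B v = H'(v) \<Omega>\<close>, this says that \<open>dh \<and> \<Omega>\<close> is alternating. If the arguments at positions \<open>i < j\<close>
  coincide, all summands but the two that omit \<open>i\<close> or \<open>j\<close> have a repeated argument; the lists in these two differ by
  moving one entry over \<open>j - i - 1\<close> places, so the signs are opposite.\<close>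

lemma alt_form_antisymmetrise:
  fixes B :: "'e::real_vector \<Rightarrow> 'e list \<Rightarrow> real"
  assumes alt: "\<And>v. alt_form p (B v)" and lin: "\<And>ws. linear (\<lambda>v. B v ws)"
  shows "alt_form (Suc p) (\<lambda>vs. \<Sum>i<length vs. (- 1) ^ i * B (vs ! i) (take i vs @ drop (Suc i) vs))"
  unfolding alt_form_def
proof (intro conjI allI impI)
  fix vs :: "'e list" assume "length vs \<noteq> Suc p"
  then show "(\<Sum>i<length vs. (- 1) ^ i * B (vs ! i) (take i vs @ drop (Suc i) vs)) = 0"
    by (intro sum.neutral) (auto simp: alt_form_length[OF alt])
next
  fix vs :: "'e list" and j assume vs: "length vs = Suc p \<and> j < Suc p"
  have "linear (\<lambda>v. B (vs[j := v] ! i) (take i (vs[j := v]) @ drop (Suc i) (vs[j := v])))"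
    if "i < Suc p" for i
  proof (cases i j rule: linorder_cases)
    case equal
    then show ?thesis using vs lin by (simp add: drop_update_cancel)
  next
    case less
    then have "take i (vs[j := v]) @ drop (Suc i) (vs[j := v]) =
        (take i vs @ drop (Suc i) (take j vs)) @ v # drop (Suc j) vs" for v
      using vs by (simp add: drop_update_swap upd_conv_take_nth_drop)
    then show ?thesis
      using less alt_form_linear[OF alt, of "vs ! i" "take i vs @ drop (Suc i) (take j vs)"] by simp
  next
    case greater
    have "take i (vs[j := v]) = (take i vs)[j := v]" for v by (rule take_update_swap)
    also have "(take i vs)[j := v] = take j vs @ v # drop (Suc j) (take i vs)" for v
      using vs that greater by (subst upd_conv_take_nth_drop) (auto simp: min_def)
    finally have "take i (vs[j := v]) @ drop (Suc i) (vs[j := v]) =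
        take j vs @ v # (drop (Suc j) (take i vs) @ drop (Suc i) vs)" for v
      using greater by simp
    then show ?thesis using greater alt_form_linear[OF alt] by simp
  qed
  then show "linear (\<lambda>v. \<Sum>i<length (vs[j := v]). (- 1) ^ i *
      B (vs[j := v] ! i) (take i (vs[j := v]) @ drop (Suc i) (vs[j := v])))"
    using linear_compose_scale_right[where 'b = real, unfolded real_scaleR_def] vs
    unfolding length_list_update by (auto intro!: linear_compose_sum simp del: sum.lessThan_Suc)
next
  fix vs :: "'e list" and i j assume ij: "length vs = Suc p \<and> i < j \<and> j < Suc p \<and> vs ! i = vs ! j"
  define a where "a = vs ! i"
  define xs where "xs = take i vs"
  define ys where "ys = take (j - Suc i) (drop (Suc i) vs)"
  define zs where "zs = drop (Suc j) vs"
  let ?t = "\<lambda>l. (- 1) ^ l * B (vs ! l) (take l vs @ drop (Suc l) vs)"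
  have vs: "vs = xs @ a # ys @ a # zs"
  proof -
    have "drop (Suc i) vs = ys @ drop j vs"
      unfolding ys_def using ij by (metis Suc_leI append_take_drop_id drop_drop le_add_diff_inverse2)
    moreover have "drop j vs = a # zs" using ij by (simp add: zs_def a_def Cons_nth_drop_Suc)
    ultimately show ?thesis
      using ij id_take_nth_drop[of i vs] by (simp add: xs_def a_def)
  qed
  have len: "length xs = i" "length ys = j - Suc i" using ij by (auto simp: xs_def ys_def)
  have other: "?t l = 0" if l: "l < Suc p" "l \<noteq> i" "l \<noteq> j" for l
  proof -
    define b where "b = vs ! l"
    consider "l < i" | "i < l" "l < j" | "j < l" using l by linarith
    then have "B b (take l vs @ drop (Suc l) vs) = 0"
    proof cases
      case 1
      then have "take l vs @ drop (Suc l) vs = (take l xs @ drop (Suc l) xs) @ a # ys @ a # zs"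
        using len by (simp add: vs)
      then show ?thesis using alt_form_repeat[OF alt] by metis
    next
      case 2
      then have "take l vs @ drop (Suc l) vs = xs @ a # (take (l - Suc i) ys @ drop (l - i) ys) @ a # zs"
        using len by (simp add: vs take_Cons' drop_Cons')
      then show ?thesis using alt_form_repeat[OF alt] by metis
    next
      case 3
      then have "take l vs @ drop (Suc l) vs =
          xs @ a # ys @ a # (take (l - Suc j) zs @ drop (l - j) zs)"
        using len ij by (simp add: vs take_Cons' drop_Cons')
      then show ?thesis using alt_form_repeat[OF alt] by metis
    qed
    then show ?thesis by (simp add: b_def)
  qed
  have "(\<Sum>l<Suc p. ?t l) = (\<Sum>l\<in>{i, j}. ?t l)"
    by (rule sum.mono_neutral_right) (use ij other in auto)
  also have "\<dots> = ?t i + ?t j" using ij by simp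
  also have "?t i = (- 1) ^ i * B a (xs @ ys @ a # zs)"
  proof -
    have "take i vs @ drop (Suc i) vs = xs @ ys @ a # zs" using len by (simp add: vs)
    then show ?thesis by (simp add: a_def)
  qed
  also have "?t j = (- 1) ^ j * B a (xs @ a # ys @ zs)"
  proof -
    have "take j vs @ drop (Suc j) vs = xs @ a # ys @ zs"
      using len ij by (simp add: vs take_Cons' drop_Cons')
    then show ?thesis using ij by (simp add: a_def)
  qed
  also have "B a (xs @ a # ys @ zs) = (- 1) ^ (j - Suc i) * B a (xs @ ys @ a # zs)"
    using alt_form_move[OF alt, of a xs a ys zs] len by simp
  also have "(- 1) ^ i * B a (xs @ ys @ a # zs) + (- 1) ^ j * ((- 1) ^ (j - Suc i) * B a (xs @ ys @ a # zs)) = 0"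
  proof -
    obtain q where j: "j = Suc (i + q)" using ij less_imp_Suc_add by blast
    have "(- 1 :: real) ^ q * (- 1) ^ q = 1" by (simp flip: power_mult_distrib)
    then have "(- 1 :: real) ^ j * (- 1) ^ (j - Suc i) = - ((- 1) ^ i)"
      by (simp add: j power_add)
    then show ?thesis by (simp flip: mult.assoc)
  qed
  finally show "(\<Sum>l<length vs. ?t l) = 0" using ij by simp
qed

text \<open>The arguments are replaced by basis vectors one at a time, from right to left; in the auxiliary claim \<open>xs\<close> is the
  part still arbitrary.\<close>

lemma alt_form_eq_0_of_Basis:
  fixes \<omega> :: "'e::euclidean_space list \<Rightarrow> real"
  assumes "alt_form p \<omega>"
    and "\<And>vs. set vs \<subseteq> Basis \<Longrightarrow> length vs = n \<Longrightarrow> \<omega> (vs @ ws) = 0"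
    and "length vs = n"
  shows "\<omega> (vs @ ws) = 0"
proof -
  have "\<omega> (xs @ ys @ ws) = 0" if "set ys \<subseteq> Basis" "length (xs @ ys) = n" for xs ys
    using that
  proof (induction xs arbitrary: ys rule: rev_induct)
    case Nil
    then show ?case using assms(2) by simp
  next
    case (snoc x xs)
    have "\<omega> (xs @ x # ys @ ws) = (\<Sum>b\<in>Basis. (x \<bullet> b) *\<^sub>R \<omega> (xs @ b # ys @ ws))"
      by (rule linear_euclidean_sum[OF alt_form_linear[OF assms(1)]])
    also have "\<dots> = 0"
      using snoc.IH[of "b # ys" for b] snoc.prems by (intro sum.neutral) auto
    finally show ?case by simp
  qed
  from this[of "[]" vs] show ?thesis using assms(3) by simp
qed

text \<open>Expand the moving arguments in the basis one after the other; \<open>xs\<close> collects the basis vectors already chosen.\<close>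

lemma smooth_on_alt_form:
  fixes \<eta> :: "'e::euclidean_space list \<Rightarrow> real"
  assumes "open S" "alt_form m \<eta>" "\<And>f. f \<in> set fs \<Longrightarrow> smooth_on S f"
  shows "smooth_on S (\<lambda>u. \<eta> (xs @ map (\<lambda>f. f u) fs))"
  using assms(3)
proof (induction fs arbitrary: xs)
  case (Cons f fs)
  have "\<eta> (xs @ f u # map (\<lambda>f. f u) fs) = (\<Sum>b\<in>Basis. (f u \<bullet> b) *\<^sub>R \<eta> ((xs @ [b]) @ map (\<lambda>f. f u) fs))" for u
    using linear_euclidean_sum[OF alt_form_linear[OF assms(2)], of xs "f u"] by simp
  moreover have "smooth_on S (\<lambda>u. \<Sum>b\<in>Basis. (f u \<bullet> b) *\<^sub>R \<eta> ((xs @ [b]) @ map (\<lambda>f. f u) fs))"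
    by (intro smooth_on_sum assms(1) smooth_on_scaleR smooth_on_inner smooth_on_const Cons.IH Cons.prems) (auto intro: Cons.prems)
  ultimately show ?case by simp
qed (simp add: smooth_on_const)

text \<open>The kernel of an alternating form does not depend on the slot in which it is tested. Nondegeneracy is
  stated for the first slot, whereas the contraction of a multivector leaves the last slot free.\<close>

lemma alt_form_last_degenerate:
  assumes "alt_form (Suc m) \<omega>" "m \<noteq> 0" "\<And>vs. length vs = m \<Longrightarrow> \<omega> (vs @ [e]) = 0"
  shows "interior_prod e \<omega> = interior_prod 0 \<omega>"
proof
  fix ws
  have "\<omega> (e # ws) = 0"
  proof (cases "length ws = m")
    case True
    with assms(2) obtain ys b where ws: "ws = ys @ [b]" by (cases ws rule: rev_cases) auto
    show ?thesis
      using alt_form_swap[OF assms(1), of "[]" e ys b "[]"] assms(3)[of "b # ys"] True ws by simp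
  qed (simp add: alt_form_length[OF assms(1)])
  moreover have "\<omega> (0 # ws) = 0"
    using linear_0[OF alt_form_linear[OF assms(1), of "[]" ws]] by simp
  ultimately show "interior_prod e \<omega> ws = interior_prod 0 \<omega> ws"
    by (simp add: interior_prod_def)
qed

text \<open>Linear algebra behind \<open>i(X)\<omega> \<and> i(X)\<alpha> = 0\<close> for \<open>X = V + s W\<close> with decomposable \<open>V\<close> and \<open>W\<close>. Subtract from
  \<open>\<alpha>\<close> the multiple of \<open>\<omega>\<close> that agrees with it on \<open>(V, w)\<close>; the difference \<open>\<beta>\<close> satisfies the same relation. From
  \<open>\<beta>(V, w) = 0\<close> the case \<open>s = 0\<close> gives \<open>\<beta>(V, \<cdot>) = 0\<close>, and the polarised relation gives
  \<open>\<omega>(V, w) \<beta>(Q, z) = \<omega>(V, z) \<beta>(Q, w)\<close> for all \<open>Q\<close>: the last argument of \<open>\<beta>\<close> only matters through the covector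
  \<open>\<omega>(V, \<cdot>)\<close>. As \<open>\<beta>\<close> is alternating in at least two arguments, such a form vanishes.\<close>

lemma alt_form_proportional:
  assumes \<omega>: "alt_form (Suc m) \<omega>" and \<alpha>: "alt_form (Suc m) \<alpha>" and m: "m \<noteq> 0"
    and eq: "\<And>V W s w1 w2. length V = m \<Longrightarrow> length W = m \<Longrightarrow>
      (\<omega> (V @ [w1]) + s * \<omega> (W @ [w1])) * (\<alpha> (V @ [w2]) + s * \<alpha> (W @ [w2])) =
      (\<omega> (V @ [w2]) + s * \<omega> (W @ [w2])) * (\<alpha> (V @ [w1]) + s * \<alpha> (W @ [w1]))"
    and V: "length V = m" and nz: "\<omega> (V @ [w]) \<noteq> 0"
  shows "\<alpha> vs = \<alpha> (V @ [w]) / \<omega> (V @ [w]) * \<omega> vs"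
proof (cases "length vs = Suc m")
  case False
  then show ?thesis by (simp add: alt_form_length[OF \<omega>] alt_form_length[OF \<alpha>])
next
  case True
  define c where "c = \<alpha> (V @ [w]) / \<omega> (V @ [w])"
  define \<beta> where "\<beta> vs = \<alpha> vs - c * \<omega> vs" for vs
  have \<beta>w: "\<beta> (V @ [w]) = 0" using nz by (simp add: \<beta>_def c_def)
  have eq1: "\<omega> (P @ [w1]) * \<beta> (P @ [w2]) = \<omega> (P @ [w2]) * \<beta> (P @ [w1])" if "length P = m" for P w1 w2
    using eq[OF that that, of w1 0 w2] by (simp add: \<beta>_def algebra_simps)
  have eq2: "\<omega> (P @ [w1]) * \<beta> (Q @ [w2]) + \<omega> (Q @ [w1]) * \<beta> (P @ [w2]) =
      \<omega> (P @ [w2]) * \<beta> (Q @ [w1]) + \<omega> (Q @ [w2]) * \<beta> (P @ [w1])"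
    if "length P = m" "length Q = m" for P Q w1 w2
    using eq[OF that, of w1 1 w2] eq1[OF that(1), of w1 w2] eq1[OF that(2), of w1 w2]
    by (simp add: \<beta>_def algebra_simps)
  have \<beta>V: "\<beta> (V @ [w2]) = 0" for w2
    using eq1[OF V, of w w2] \<beta>w nz by simp
  have key: "\<omega> (V @ [w]) * \<beta> (Q @ [w2]) = \<omega> (V @ [w2]) * \<beta> (Q @ [w])" if "length Q = m" for Q w2
    using eq2[OF V that, of w w2] \<beta>V by simp
  from True m obtain y ys z where vs: "vs = y # ys @ [z]"
    by (metis Suc_length_conv append_butlast_last_id length_0_conv)
  have \<beta>_swap: "\<beta> (a # ys @ [b]) = - \<beta> (b # ys @ [a])" for a b
    using alt_form_swap[OF \<omega>, of "[]" a ys b "[]"] alt_form_swap[OF \<alpha>, of "[]" a ys b "[]"]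
    by (simp add: \<beta>_def)
  have "\<beta> (w # ys @ [w]) = 0" using \<beta>_swap[of w w] by simp
  then have "\<beta> (w # ys @ [y]) = 0"
    using key[of "w # ys" y] nz True vs by simp
  then have "\<beta> (y # ys @ [w]) = 0" using \<beta>_swap[of y w] by simp
  then have "\<beta> (y # ys @ [z]) = 0"
    using key[of "y # ys" z] nz True vs by simp
  then show ?thesis by (simp add: vs \<beta>_def c_def)
qed

text \<open>For \<open>V\<close> with \<open>i(V)\<omega> \<noteq> 0\<close> the product relation gives \<open>\<alpha>(V) = 0\<close>, and a general argument is reached from such a
  \<open>V\<close> by polarisation.\<close>

lemma alt_form_eq_0_of_product:
  assumes \<omega>: "alt_form (Suc m) \<omega>" and \<alpha>: "alt_form m \<alpha>"
    and eq: "\<And>V W s w. length V = m \<Longrightarrow> length W = m \<Longrightarrow>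
      (\<omega> (V @ [w]) + s * \<omega> (W @ [w])) * (\<alpha> V + s * \<alpha> W) = 0"
    and V: "length V = m" and nz: "\<omega> (V @ [w]) \<noteq> 0"
  shows "\<alpha> vs = 0"
proof (cases "length vs = m")
  case True
  have "\<alpha> V = 0" using eq[OF V V, of w 0] nz by simp
  then show ?thesis
    using eq[OF V True, of w 1] eq[OF True True, of w 0] nz by (auto simp: algebra_simps)
qed (simp add: alt_form_length[OF \<alpha>])

section \<open>Multivector fields supported in a chart\<close>

lemma alt_form_map:
  fixes \<eta> :: "'b::real_vector list \<Rightarrow> real" and T :: "'a::real_vector \<Rightarrow> 'b"
  assumes "alt_form m \<eta>" and T: "linear T"
  shows "alt_form m (\<lambda>vs. \<eta> (map T vs))"
  unfolding alt_form_def
proof (intro conjI allI impI)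
  fix vs :: "'a list" and i assume i: "length vs = m \<and> i < m"
  then have "linear (\<lambda>v. \<eta> ((map T vs)[i := v]))" using assms(1) by (simp add: alt_form_def)
  from linear_compose[OF T this] show "linear (\<lambda>v. \<eta> (map T (vs[i := v])))"
    by (simp add: map_update comp_def)
next
  fix vs :: "'a list" and i j assume "length vs = m \<and> i < j \<and> j < m \<and> vs ! i = vs ! j"
  then show "\<eta> (map T vs) = 0"
    using assms(1)[unfolded alt_form_def, THEN conjunct2, THEN conjunct2, rule_format, of "map T vs" i j]
    by simp
qed (simp add: alt_form_length[OF assms(1)])

text \<open>The functional \<^const>\<open>wedge\<close> is set to zero off the alternating forms, so the contraction may be evaluated
  termwise only once the contracted form is known to be alternating.\<close>

lemma contract_sum_wedge:
  assumes "alt_form p \<omega>"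
  shows "contract (\<lambda>\<eta>. \<Sum>V\<in>I. a V * wedge (g V) \<eta>) \<omega> ws = (\<Sum>V\<in>I. a V * \<omega> (rev (g V) @ ws))"
  using contract_wedge[OF assms] by (simp add: contract_def fun_eq_iff foldr_interior_prod)

text \<open>The multivector field \<open>\<Sum>V\<in>I. a\<^sub>V V\<close> with constant decomposables \<open>V\<close> in the coordinates of \<open>c\<close>, extended by zero.
  Across the boundary of the chart, smoothness comes from coefficients with compact support in \<^term>\<open>cimg c\<close>.\<close>

definition chart_mv ::
  "('m, 'e::euclidean_space) chart set \<Rightarrow> ('m, 'e) chart \<Rightarrow> 'e list set \<Rightarrow> ('e list \<Rightarrow> 'e \<Rightarrow> real) \<Rightarrow>
   'm \<Rightarrow> ('e list \<Rightarrow> real) \<Rightarrow> real" where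
  "chart_mv A c I a x = (if x \<in> cdom c
     then (\<lambda>\<omega>. \<Sum>V\<in>I. a V (coord c x) * wedge (map (tchange c (chart_at A x) x) V) \<omega>) else (\<lambda>\<omega>. 0))"

context
  fixes A :: "('m::t2_space, 'e::euclidean_space) chart set"
  assumes A: "smooth_atlas A"
begin

lemma chart_open:
  assumes "c \<in> A" shows "open (cdom c)" "open (cimg c)"
  using A assms by (auto simp: smooth_atlas_def is_chart_def)

lemma cinv_coord: "c \<in> A \<Longrightarrow> x \<in> cdom c \<Longrightarrow> cinv c (coord c x) = x"
  using A by (auto simp: smooth_atlas_def is_chart_def homeomorphism_def)

lemma coord_cinv: "c \<in> A \<Longrightarrow> u \<in> cimg c \<Longrightarrow> coord c (cinv c u) = u"
  using A by (auto simp: smooth_atlas_def is_chart_def homeomorphism_def)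

lemma cinv_in: "c \<in> A \<Longrightarrow> u \<in> cimg c \<Longrightarrow> cinv c u \<in> cdom c"
  using A by (auto simp: smooth_atlas_def is_chart_def homeomorphism_def)

lemma continuous_on_cinv: "c \<in> A \<Longrightarrow> continuous_on (cimg c) (cinv c)"
  using A by (auto simp: smooth_atlas_def is_chart_def homeomorphism_def)

lemma open_coord_image:
  assumes "c \<in> A" "open U" shows "open (coord c ` (cdom c \<inter> U))"
proof -
  have "coord c ` (cdom c \<inter> U) = cimg c \<inter> cinv c -` U"
    using cinv_coord[OF assms(1)] by (force simp: image_iff)
  then show ?thesis
    using continuous_open_preimage[OF continuous_on_cinv[OF assms(1)] chart_open(2)[OF assms(1)] assms(2)]
    by simp
qed

lemma chart_at: "chart_at A x \<in> A" "x \<in> cdom (chart_at A x)"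
proof -
  have "\<exists>c. c \<in> A \<and> x \<in> cdom c" using A by (auto simp: smooth_atlas_def)
  from someI_ex[OF this] show "chart_at A x \<in> A" "x \<in> cdom (chart_at A x)"
    by (simp_all add: chart_at_def)
qed

lemma smooth_transition:
  assumes "c \<in> A" "c' \<in> A"
  shows "smooth_on (coord c ` (cdom c \<inter> cdom c')) (\<lambda>u. coord c' (cinv c u))"
  using A assms by (simp add: smooth_atlas_def comp_def)

lemma tchange_has_derivative:
  assumes "c \<in> A" "c' \<in> A" "x \<in> cdom c" "x \<in> cdom c'"
  shows "((\<lambda>u. coord c' (cinv c u)) has_derivative tchange c c' x) (at (coord c x))"
  unfolding tchange_def comp_def
  by (rule smooth_on_has_derivative[OF smooth_transition]) (use assms in auto)

lemma linear_tchange: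
  assumes "c \<in> A" "c' \<in> A" "x \<in> cdom c" "x \<in> cdom c'"
  shows "linear (tchange c c' x)"
  using tchange_has_derivative[OF assms] by (rule has_derivative_linear)

text \<open>The cocycle identity; it makes computations independent of the reference chart \<^term>\<open>chart_at A x\<close> in which tangent
  vectors at \<open>x\<close> are represented.\<close>

lemma tchange_tchange:
  assumes "c \<in> A" "c' \<in> A" "c'' \<in> A" "x \<in> cdom c" "x \<in> cdom c'" "x \<in> cdom c''"
  shows "tchange c' c'' x (tchange c c' x v) = tchange c c'' x v"
proof -
  have "((\<lambda>u. coord c'' (cinv c' (coord c' (cinv c u)))) has_derivative
      (\<lambda>v. tchange c' c'' x (tchange c c' x v))) (at (coord c x))"
    by (rule has_derivative_compose[OF tchange_has_derivative])
      (use assms tchange_has_derivative[of c' c'' x] in \<open>simp_all add: cinv_coord\<close>)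
  then have "((\<lambda>u. coord c'' (cinv c u)) has_derivative
      (\<lambda>v. tchange c' c'' x (tchange c c' x v))) (at (coord c x))"
    by (rule has_derivative_transform_within_open[OF _ open_coord_image[OF assms(1) chart_open(1)[OF assms(2)]]])
      (use assms in \<open>auto simp: cinv_coord\<close>)
  from has_derivative_unique[OF this tchange_has_derivative[of c c'' x]] assms
  show ?thesis by (auto dest: fun_cong)
qed

lemma tchange_self:
  assumes "c \<in> A" "x \<in> cdom c"
  shows "tchange c c x v = v"
proof -
  have "((\<lambda>u. coord c (cinv c u)) has_derivative (\<lambda>v. v)) (at (coord c x))"
    by (rule has_derivative_transform_within_open[OF has_derivative_ident chart_open(2)[OF assms(1)]])
      (use assms in \<open>auto simp: coord_cinv\<close>)
  from has_derivative_unique[OF this tchange_has_derivative[of c c x]] assms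
  show ?thesis by (metis)
qed

lemma alt_form_form_rep:
  assumes "alt_form p (\<omega> (cinv c u))" "c \<in> A" "u \<in> cimg c"
  shows "alt_form p (form_rep A \<omega> c u)"
  unfolding form_rep_def Let_def
  by (rule alt_form_map[OF assms(1) linear_tchange]) (use assms chart_at in \<open>auto intro: cinv_in\<close>)

text \<open>The value at \<open>x\<close> is already expressed in the reference chart, which is also the chart used by
  \<^const>\<open>ext_deriv\<close> at \<open>x\<close>; this is why the later computations at a point are carried out in that chart.\<close>

lemma form_rep_chart_at:
  "form_rep A \<omega> (chart_at A x) (coord (chart_at A x) x) vs = \<omega> x vs"
  using chart_at[of x] by (simp add: form_rep_def cinv_coord tchange_self map_idI)

text \<open>Since the manifold is Hausdorff, the compact set \<open>cinv c ` B\<close> is closed; so every point of the second chart has a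
  neighbourhood inside \<open>cdom c\<close> or one on which \<open>\<Phi>\<close> vanishes.\<close>

lemma smooth_on_extension_by_zero:
  assumes c: "c \<in> A" "c' \<in> A" and B: "compact B" "B \<subseteq> cimg c"
    and sm: "smooth_on (coord c' ` (cdom c' \<inter> cdom c)) \<Phi>"
    and 0: "\<And>u. u \<in> cimg c' \<Longrightarrow> cinv c' u \<notin> cinv c ` B \<Longrightarrow> \<Phi> u = 0"
  shows "smooth_on (cimg c') \<Phi>"
proof (rule smooth_on_local)
  fix u assume u: "u \<in> cimg c'"
  have "compact (cinv c ` B)"
    by (rule compact_continuous_image[OF continuous_on_subset[OF continuous_on_cinv] B(1)]) (use c B in auto)
  then have cl: "closed (cinv c ` B)" by (rule compact_imp_closed)
  have B_in: "cinv c ` B \<subseteq> cdom c" using B cinv_in[OF c(1)] by blast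
  show "\<exists>T. open T \<and> u \<in> T \<and> smooth_on T \<Phi>"
  proof (cases "cinv c' u \<in> cdom c")
    case True
    then have "u \<in> coord c' ` (cdom c' \<inter> cdom c)"
      using coord_cinv[OF c(2) u] cinv_in[OF c(2) u] by force
    then show ?thesis using sm open_coord_image[OF c(2) chart_open(1)[OF c(1)]] by blast
  next
    case False
    let ?T = "coord c' ` (cdom c' \<inter> - (cinv c ` B))"
    have T: "open ?T" using cl by (intro open_coord_image c) auto
    have "u \<in> ?T" using coord_cinv[OF c(2) u] cinv_in[OF c(2) u] False B_in by force
    moreover have "smooth_on ?T \<Phi>"
    proof (rule smooth_on_cong[OF T _ smooth_on_const])
      fix u' assume "u' \<in> ?T"
      then show "0 = \<Phi> u'" using 0[of u'] cinv_coord[OF c(2)] by auto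
    qed
    ultimately show ?thesis using T by blast
  qed
qed

lemma multivector_field_chart_mv:
  assumes c: "c \<in> A" and B: "compact B" "B \<subseteq> cimg c" and I: "finite I" "\<And>V. V \<in> I \<Longrightarrow> length V = m"
    and sm: "\<And>V. V \<in> I \<Longrightarrow> smooth_on (cimg c) (a V)"
    and supp: "\<And>V u. V \<in> I \<Longrightarrow> u \<in> cimg c \<Longrightarrow> u \<notin> B \<Longrightarrow> a V u = 0"
  shows "multivector_field A m (chart_mv A c I a)"
  unfolding multivector_field_def
proof (intro conjI allI ballI impI)
  fix x
  show "multivector m (chart_mv A c I a x)"
  proof (cases "x \<in> cdom c")
    case True
    obtain h where h: "bij_betw h {..<card I} I"
      using ex_bij_betw_nat_finite[OF I(1)] by (auto simp: atLeast0LessThan)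
    let ?W = "\<lambda>V. map (tchange c (chart_at A x) x) V"
    have "chart_mv A c I a x = (\<lambda>\<omega>. \<Sum>j<card I. a (h j) (coord c x) * wedge (?W (h j)) \<omega>)"
      using True by (simp add: chart_mv_def sum.reindex_bij_betw[OF h, of "\<lambda>V. a V (coord c x) * wedge (?W V) _"])
    moreover have "\<forall>j<card I. length (?W (h j)) = m"
      using bij_betwE[OF h] I(2) by simp
    ultimately show ?thesis
      unfolding multivector_def
      by (intro exI[of _ "card I"] exI[of _ "\<lambda>j. a (h j) (coord c x)"] exI[of _ "\<lambda>j. ?W (h j)"]) blast
  next
    case False
    then show ?thesis unfolding multivector_def chart_mv_def by (intro exI[of _ 0]) simp
  qed
next
  fix c' and \<eta> :: "'e list \<Rightarrow> real" assume c': "c' \<in> A" and \<eta>: "alt_form m \<eta>"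
  define \<Phi> where "\<Phi> u = (let x = cinv c' u in
      chart_mv A c I a x (\<lambda>vs. \<eta> (map (tchange (chart_at A x) c' x) vs)))" for u
  have \<Phi>: "\<Phi> (coord c' x) = (\<Sum>V\<in>I. a V (coord c x) * \<eta> (map (tchange c c' x) V))"
    if x: "x \<in> cdom c'" "x \<in> cdom c" for x
  proof -
    have "alt_form m (\<lambda>vs. \<eta> (map (tchange (chart_at A x) c' x) vs))"
      by (rule alt_form_map[OF \<eta> linear_tchange]) (use chart_at c' x in auto)
    then show ?thesis
      using x I(2) chart_at[of x] c c'
      by (simp add: \<Phi>_def chart_mv_def cinv_coord wedge_def tchange_tchange comp_def cong: sum.cong)
  qed
  let ?T = "coord c' ` (cdom c' \<inter> cdom c)" and ?T' = "coord c ` (cdom c \<inter> cdom c')"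
  have T: "open ?T" "open ?T'"
    by (intro open_coord_image chart_open c c')+
  have tr: "(\<lambda>u. coord c (cinv c' u)) ` ?T \<subseteq> ?T'"
    using cinv_coord[OF c'] by auto
  have tsm: "smooth_on ?T (\<lambda>u. tchange c c' (cinv c' u) v)" for v
  proof -
    have "smooth_on ?T' (\<lambda>u. frechet_derivative (\<lambda>u. coord c' (cinv c u)) (at u) v)"
      by (intro smooth_on_frechet_derivative smooth_transition c c')
    from smooth_on_compose[OF T tr smooth_transition[OF c' c] this]
    show ?thesis by (simp add: tchange_def comp_def)
  qed
  have "smooth_on ?T \<Phi>"
  proof (rule smooth_on_cong[OF T(1)])
    show "smooth_on ?T (\<lambda>u. \<Sum>V\<in>I. a V (coord c (cinv c' u)) *
        \<eta> ([] @ map (\<lambda>f. f u) (map (\<lambda>v u. tchange c c' (cinv c' u) v) V)))"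
    proof (intro smooth_on_sum smooth_on_mult T I(1) smooth_on_alt_form[OF T(1) \<eta>])
      fix V assume "V \<in> I"
      then show "smooth_on ?T (\<lambda>u. a V (coord c (cinv c' u)))"
        using tr by (intro smooth_on_compose[OF T(1) chart_open(2)[OF c] _ smooth_transition[OF c' c] sm]) auto
    qed (use tsm in auto)
    show "(\<Sum>V\<in>I. a V (coord c (cinv c' u)) *
        \<eta> ([] @ map (\<lambda>f. f u) (map (\<lambda>v u. tchange c c' (cinv c' u) v) V))) = \<Phi> u" if "u \<in> ?T" for u
      using that \<Phi> cinv_coord[OF c'] by (auto simp: comp_def)
  qed
  moreover have "\<Phi> u = 0" if u: "u \<in> cimg c'" "cinv c' u \<notin> cinv c ` B" for u
  proof (cases "cinv c' u \<in> cdom c")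
    case True
    then have "coord c (cinv c' u) \<notin> B" using u(2) cinv_coord[OF c, of "cinv c' u"] by (metis imageI)
    then show ?thesis
      using \<Phi>[OF cinv_in[OF c' u(1)] True] coord_cinv[OF c' u(1)] supp True by simp
  next
    case False
    then show ?thesis by (simp add: \<Phi>_def chart_mv_def)
  qed
  ultimately have "smooth_on (cimg c') \<Phi>"
    by (rule smooth_on_extension_by_zero[OF c c' B])
  then show "smooth_on (cimg c') (\<lambda>u. let x = cinv c' u in
      chart_mv A c I a x (\<lambda>vs. \<eta> (map (tchange (chart_at A x) c' x) vs)))"
    by (simp add: \<Phi>_def[abs_def])
qed

lemma form_rep_contract_chart_mv:
  assumes c: "c \<in> A" "c' \<in> A" and \<omega>: "\<And>x. alt_form p (\<omega> x)" and x: "x \<in> cdom c'"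
  shows "form_rep A (contract_field (chart_mv A c I a) \<omega>) c' (coord c' x) ws =
    (if x \<in> cdom c then \<Sum>V\<in>I. a V (coord c x) * form_rep A \<omega> c (coord c x) (rev V @ map (tchange c' c x) ws) else 0)"
proof (cases "x \<in> cdom c")
  case True
  then show ?thesis
    using chart_at[of x] c x
    by (simp add: form_rep_def cinv_coord contract_field_def chart_mv_def contract_sum_wedge[OF \<omega>]
        rev_map tchange_tchange comp_def)
next
  case False
  then show ?thesis
    using c x by (simp add: form_rep_def cinv_coord contract_field_def chart_mv_def contract_def)
qed

text \<open>By the chain rule, the contraction equals \<open>dg\<close> in every chart, where \<open>g\<close> is \<open>G\<close> extended by zero. Hence closedness,
  which is tested at each point in its own reference chart, is the symmetry of the second derivatives of \<open>g\<close> there.\<close>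

lemma closed_form_contract_chart_mv:
  assumes c: "c \<in> A" and B: "compact B" "B \<subseteq> cimg c"
    and \<omega>: "\<And>x. alt_form (Suc m) (\<omega> x)" and I: "\<And>V. V \<in> I \<Longrightarrow> length V = m"
    and G: "smooth_on (cimg c) G" "\<And>u. u \<in> cimg c \<Longrightarrow> u \<notin> B \<Longrightarrow> G u = 0"
    and eq: "\<And>u v. u \<in> cimg c \<Longrightarrow>
      (\<Sum>V\<in>I. a V u * form_rep A \<omega> c u (rev V @ [v])) = frechet_derivative G (at u) v"
  shows "closed_form A (contract_field (chart_mv A c I a) \<omega>)"
  unfolding closed_form_def
proof (intro allI)
  fix x :: 'm and vs :: "'e list"
  let ?\<beta> = "contract_field (chart_mv A c I a) \<omega>"
  define c' where "c' = chart_at A x"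
  have c': "c' \<in> A" and x: "x \<in> cdom c'" unfolding c'_def by (rule chart_at)+
  define g where "g u = (if cinv c' u \<in> cdom c then G (coord c (cinv c' u)) else 0)" for u
  have g_eq: "g u = G (coord c (cinv c' u))" if "u \<in> coord c' ` (cdom c' \<inter> cdom c)" for u
    using that cinv_coord[OF c'] by (auto simp: g_def)
  have T: "open (coord c' ` (cdom c' \<inter> cdom c))" by (intro open_coord_image chart_open c c')
  have g: "smooth_on (cimg c') g"
  proof (rule smooth_on_extension_by_zero[OF c c' B])
    show "smooth_on (coord c' ` (cdom c' \<inter> cdom c)) g"
    proof (rule smooth_on_cong[OF T])
      show "smooth_on (coord c' ` (cdom c' \<inter> cdom c)) (\<lambda>u. G (coord c (cinv c' u)))"
        by (rule smooth_on_compose[OF T chart_open(2)[OF c] _ smooth_transition[OF c' c] G(1)])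
          (use cinv_coord[OF c'] in auto)
    qed (simp add: g_eq)
    show "g u = 0" if "u \<in> cimg c'" "cinv c' u \<notin> cinv c ` B" for u
    proof (cases "cinv c' u \<in> cdom c")
      case True
      then have "coord c (cinv c' u) \<notin> B" using that cinv_coord[OF c, of "cinv c' u"] by (metis imageI)
      then show ?thesis using G(2) True by (simp add: g_def)
    qed (simp add: g_def)
  qed
  have rep: "form_rep A ?\<beta> c' u [v] = frechet_derivative g (at u) v" if u: "u \<in> cimg c'" for u v
  proof -
    define y where "y = cinv c' u"
    have y: "y \<in> cdom c'" "u = coord c' y"
      unfolding y_def using cinv_in[OF c' u] coord_cinv[OF c' u] by auto
    show ?thesis
    proof (cases "y \<in> cdom c")
      case True
      then have "((\<lambda>u. G (coord c (cinv c' u))) has_derivative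
          (\<lambda>v. frechet_derivative G (at (coord c y)) (tchange c' c y v))) (at (coord c' y))"
        using smooth_on_has_derivative[OF G(1), of "coord c y"] y
        by (intro has_derivative_compose[OF tchange_has_derivative[OF c' c]]) (auto simp: cinv_coord[OF c'])
      then have "(g has_derivative
          (\<lambda>v. frechet_derivative G (at (coord c y)) (tchange c' c y v))) (at (coord c' y))"
        by (rule has_derivative_transform_within_open[OF _ T]) (use True y in \<open>auto simp: g_eq\<close>)
      from fun_cong[OF frechet_derivative_at[OF this], of v] show ?thesis
        using form_rep_contract_chart_mv[where ws = "[v]" and \<omega> = \<omega>, OF c c' \<omega> y(1)] True eq[of "coord c y"] y by simp
    next
      case False
      let ?T = "coord c' ` (cdom c' \<inter> - (cinv c ` B))"
      have "compact (cinv c ` B)"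
        by (rule compact_continuous_image[OF continuous_on_subset[OF continuous_on_cinv] B(1)]) (use c B in auto)
      then have T: "open ?T" by (intro open_coord_image c') (simp add: compact_imp_closed open_Compl)
      have "y \<notin> cinv c ` B" using False B cinv_in[OF c] by blast
      then have "u \<in> ?T" using y by blast
      moreover have "g u' = 0" if "u' \<in> ?T" for u'
      proof (cases "cinv c' u' \<in> cdom c")
        case True
        moreover have "cinv c' u' \<notin> cinv c ` B" using that cinv_coord[OF c'] by auto
        ultimately have "coord c (cinv c' u') \<notin> B" using cinv_coord[OF c, of "cinv c' u'"] by (metis imageI)
        then show ?thesis using G(2) True by (simp add: g_def)
      qed (simp add: g_def)
      ultimately have "(g has_derivative (\<lambda>v. 0)) (at u)"
        by (intro has_derivative_transform_within_open[OF has_derivative_const[of 0] T]) auto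
      from fun_cong[OF frechet_derivative_at[OF this], of v] show ?thesis
        using form_rep_contract_chart_mv[where ws = "[v]" and \<omega> = \<omega>, OF c c' \<omega> y(1)] False y by simp
    qed
  qed
  have rep0: "form_rep A ?\<beta> c' u ws = 0" if "length ws \<noteq> 1" for u ws
  proof -
    have "contract (chart_mv A c I a y) (\<omega> y) ws' = 0" if "length ws' \<noteq> 1" for y ws'
    proof (cases "y \<in> cdom c")
      case True
      show ?thesis
        unfolding chart_mv_def using True that I
        by (simp add: contract_sum_wedge[OF \<omega>] alt_form_length[OF \<omega>] sum.neutral)
    qed (simp add: chart_mv_def contract_def)
    then show ?thesis using that by (simp add: form_rep_def contract_field_def Let_def)
  qed
  show "ext_deriv A ?\<beta> x vs = 0"
  proof (cases "length vs = 2")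
    case False
    have "form_rep A ?\<beta> c' u (take i vs @ drop (Suc i) vs) = 0" if "i < length vs" for u i
      by (rule rep0) (use False that in auto)
    then show ?thesis by (auto simp: ext_deriv_def c'_def[symmetric] intro!: sum.neutral)
  next
    case True
    then obtain v w where vs: "vs = [v, w]" by (auto simp: length_Suc_conv numeral_2_eq_2)
    have D: "frechet_derivative (\<lambda>u. form_rep A ?\<beta> c' u [v]) (at (coord c' x)) =
        frechet_derivative (\<lambda>u. frechet_derivative g (at u) v) (at (coord c' x))" for v
    proof -
      have "((\<lambda>u. form_rep A ?\<beta> c' u [v]) has_derivative
          frechet_derivative (\<lambda>u. frechet_derivative g (at u) v) (at (coord c' x))) (at (coord c' x))"
        by (rule has_derivative_transform_within_open[OF
            smooth_on_has_derivative[OF smooth_on_frechet_derivative[OF g]] chart_open(2)[OF c']])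
          (use x rep in auto)
      from frechet_derivative_at[OF this] show ?thesis by simp
    qed
    show ?thesis
      using second_derivative_symmetric[OF chart_open(2)[OF c'] g, of "coord c' x" v w] x
      by (simp add: ext_deriv_def vs c'_def[symmetric] D numeral_2_eq_2)
  qed
qed

end

section \<open>Locally Hamiltonian multivector fields\<close>

context
  fixes A :: "('m::t2_space, 'e::euclidean_space) chart set"
    and m :: nat and \<Omega> :: "'m \<Rightarrow> 'e list \<Rightarrow> real"
  assumes A: "smooth_atlas A" and \<Omega>: "multisymplectic A (Suc m) \<Omega>"
begin

lemma m_nz: "m \<noteq> 0" and alt_\<Omega>: "alt_form (Suc m) (\<Omega> x)" and closed_\<Omega>: "closed_form A \<Omega>"
  and smooth_\<Omega>: "c \<in> A \<Longrightarrow> smooth_on (cimg c) (\<lambda>u. form_rep A \<Omega> c u vs)"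
  using \<Omega> by (auto simp: multisymplectic_def diff_form_def)

lemma multisymplectic_nondegenerate_last:
  assumes "\<And>P. length P = m \<Longrightarrow> \<Omega> x (P @ [v]) = 0"
  shows "v = 0"
proof -
  have "interior_prod v (\<Omega> x) = interior_prod 0 (\<Omega> x)"
    by (rule alt_form_last_degenerate[OF alt_\<Omega> m_nz assms])
  moreover have "inj (\<lambda>v. interior_prod v (\<Omega> x))"
    using \<Omega> by (simp add: multisymplectic_def)
  ultimately show ?thesis by (auto dest: injD)
qed

lemma multisymplectic_nondegenerate_chart:
  assumes c: "c \<in> A" and u: "u \<in> cimg c"
    and 0: "\<And>P. length P = m \<Longrightarrow> form_rep A \<Omega> c u (P @ [v]) = 0"
  shows "v = 0"
proof -
  define x where "x = cinv c u"
  have x: "x \<in> cdom c" "u = coord c x"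
    unfolding x_def using cinv_in[OF A c u] coord_cinv[OF A c u] by auto
  note ch = chart_at[OF A, of x]
  have "tchange c (chart_at A x) x v = 0"
  proof (rule multisymplectic_nondegenerate_last[of x])
    fix P :: "'e list" assume P: "length P = m"
    have "\<Omega> x (P @ [tchange c (chart_at A x) x v]) =
        \<Omega> x (map (tchange c (chart_at A x) x) (map (tchange (chart_at A x) c x) P @ [v]))"
      using ch c x by (simp add: tchange_tchange[OF A] tchange_self[OF A] map_idI)
    also have "\<dots> = form_rep A \<Omega> c u (map (tchange (chart_at A x) c x) P @ [v])"
      by (simp add: form_rep_def x_def Let_def)
    finally show "\<Omega> x (P @ [tchange c (chart_at A x) x v]) = 0" using 0 P by simp
  qed
  then have "tchange (chart_at A x) c x (tchange c (chart_at A x) x v) = 0"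
    using linear_0[OF linear_tchange[OF A]] ch c x by simp
  then show ?thesis using ch c x by (simp add: tchange_tchange[OF A] tchange_self[OF A])
qed

text \<open>In the chart \<open>c\<close>, let \<open>r U u\<close> be the covector \<open>\<Omega>\<^sub>u(U, \<cdot>)\<close>, identified with a vector, where \<open>U\<close> runs
  over a finite set \<open>I\<close> of \<open>m\<close>-lists containing all lists of basis vectors. By nondegeneracy the vectors \<open>r U u\<close> span, so the
  Gram operator \<open>S u v = (\<Sum>U\<in>I. (r U u \<bullet> v) r U u)\<close> is positive definite and every covector is of the form
  \<open>\<Sum>U\<in>I. (r U u \<bullet> w) r U u\<close> with \<open>w\<close> depending smoothly on \<open>u\<close>.

  Start with the prescribed value \<open>V + s W\<close>, cut off by a bump function \<open>\<psi>\<close>, and let \<open>G\<close> be \<open>\<psi>\<close> times the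
  affine function whose differential at \<open>u0\<close> is \<open>i(V + s W)\<Omega>\<close>. The defect \<open>h = dG - \<psi> i(V + s W)\<Omega>\<close> is
  corrected by means of \<open>S\<close>. It vanishes at \<open>u0\<close> and off the support of \<open>\<psi>\<close>, so that the correction spoils neither the
  value at \<open>u0\<close> nor the support. The lists are reversed because contraction with \<open>v\<^sub>1 \<and> \<dots> \<and> v\<^sub>m\<close> inserts \<open>v\<^sub>m\<close> first.\<close>

lemma hamiltonian_multivector_coefficients:
  assumes c: "c \<in> A" and u0: "u0 \<in> cimg c" and V: "length V = m" and W: "length W = m"
  obtains I a G B where "finite I" "\<And>U. U \<in> I \<Longrightarrow> length U = m" "compact B" "B \<subseteq> cimg c"
    "\<And>U. U \<in> I \<Longrightarrow> smooth_on (cimg c) (a U)" "\<And>U u. U \<in> I \<Longrightarrow> u \<in> cimg c \<Longrightarrow> u \<notin> B \<Longrightarrow> a U u = 0"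
    "smooth_on (cimg c) G" "\<And>u. u \<in> cimg c \<Longrightarrow> u \<notin> B \<Longrightarrow> G u = 0" "G u0 = (0::real)"
    "\<And>u v. u \<in> cimg c \<Longrightarrow>
      (\<Sum>U\<in>I. a U u * form_rep A \<Omega> c u (rev U @ [v])) = frechet_derivative G (at u) v"
    "\<And>F. (\<Sum>U\<in>I. a U u0 * F U) = F V + s * F W"
proof -
  note op = chart_open(2)[OF A c]
  \<comment> \<open>\<open>V\<close> and \<open>W\<close> are added to the basis lists so that one index set serves the value at \<open>u0\<close> and the correction\<close>
  define I where "I = {V, W} \<union> {P. set P \<subseteq> Basis \<and> length P = m}"
  have I: "finite I" and len: "\<And>U. U \<in> I \<Longrightarrow> length U = m"
    unfolding I_def using finite_lists_length_eq[OF finite_Basis] V W by auto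
  \<comment> \<open>the coefficients of \<open>V + s W\<close>; the summands add up if \<open>V = W\<close>\<close>
  define b :: "'e list \<Rightarrow> real" where "b U = (if U = V then 1 else 0) + s * (if U = W then 1 else 0)" for U
  define r where "r U u = (\<Sum>e\<in>Basis. form_rep A \<Omega> c u (rev U @ [e]) *\<^sub>R e)" for U u
  have r_smooth: "smooth_on (cimg c) (r U)" for U
    unfolding r_def by (intro smooth_on_sum smooth_on_scaleR smooth_on_const smooth_\<Omega> c op finite_Basis)
  have r: "r U u \<bullet> v = form_rep A \<Omega> c u (rev U @ [v])" if "u \<in> cimg c" for U u v
  proof -
    have "form_rep A \<Omega> c u (rev U @ [v]) = (\<Sum>e\<in>Basis. (v \<bullet> e) *\<^sub>R form_rep A \<Omega> c u (rev U @ [e]))"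
      by (rule linear_euclidean_sum[OF alt_form_linear[OF alt_form_form_rep[OF A alt_\<Omega> c that]]])
    then show ?thesis by (simp add: r_def inner_sum_left inner_commute[of v] mult.commute)
  qed
  define S where "S u v = (\<Sum>U\<in>I. (r U u \<bullet> v) *\<^sub>R r U u)" for u v
  have S_lin: "linear (S u)" for u
    unfolding S_def by (rule linearI)
      (simp_all add: inner_add_right scaleR_left_distrib sum.distrib scaleR_sum_right)
  have S_0: "v = 0" if u: "u \<in> cimg c" and "S u v = 0" for u v
  proof -
    have "(\<Sum>U\<in>I. (r U u \<bullet> v)\<^sup>2) = S u v \<bullet> v"
      by (simp add: S_def inner_sum_left power2_eq_square)
    then have rv: "r U u \<bullet> v = 0" if "U \<in> I" for U
      using \<open>S u v = 0\<close> that I by (simp add: sum_nonneg_eq_0_iff)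
    have "form_rep A \<Omega> c u (P @ [v]) = 0" if "set P \<subseteq> Basis" "length P = m" for P
      using rv[of "rev P"] r[OF u, of "rev P" v] that by (simp add: I_def)
    from alt_form_eq_0_of_Basis[OF alt_form_form_rep[OF A alt_\<Omega> c u] this]
    show ?thesis by (intro multisymplectic_nondegenerate_chart[OF c u]) auto
  qed
  have S_inj: "inj (S u)" if "u \<in> cimg c" for u
    using S_0[OF that] by (subst linear_injective_0[OF S_lin]) auto
  have S_smooth: "smooth_on (cimg c) (\<lambda>u. S u v)" for v
    unfolding S_def by (intro smooth_on_sum smooth_on_scaleR smooth_on_inner smooth_on_const r_smooth op I)
  obtain \<psi> :: "'e \<Rightarrow> real" and B where B: "compact B" "B \<subseteq> cimg c" and \<psi>: "smooth_on UNIV \<psi>" "\<psi> u0 = 1"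
    and \<psi>0: "\<And>u. u \<notin> B \<Longrightarrow> \<psi> u = 0"
    using smooth_bump[OF op u0] by metis
  have \<psi>_smooth: "smooth_on (cimg c) \<psi>" using \<psi>(1) by (rule smooth_on_subset) simp
  define l where "l = (\<Sum>U\<in>I. b U *\<^sub>R r U u0)"
  define G where "G u = \<psi> u * (l \<bullet> (u - u0))" for u
  have G_smooth: "smooth_on (cimg c) G" unfolding G_def
    by (intro smooth_on_mult smooth_on_inner smooth_on_diff smooth_on_ident smooth_on_const \<psi>_smooth op)
  define \<gamma> where "\<gamma> u = (\<Sum>e\<in>Basis. frechet_derivative G (at u) e *\<^sub>R e)" for u
  have \<gamma>: "\<gamma> u \<bullet> v = frechet_derivative G (at u) v" if "u \<in> cimg c" for u v
  proof -
    have "frechet_derivative G (at u) v = (\<Sum>e\<in>Basis. (v \<bullet> e) *\<^sub>R frechet_derivative G (at u) e)"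
      by (rule linear_euclidean_sum[OF has_derivative_linear[OF smooth_on_has_derivative[OF G_smooth that]]])
    then show ?thesis by (simp add: \<gamma>_def inner_sum_left inner_commute[of v] mult.commute)
  qed
  define h where "h u = \<gamma> u - \<psi> u *\<^sub>R (\<Sum>U\<in>I. b U *\<^sub>R r U u)" for u
  have "smooth_on (cimg c) h"
    unfolding h_def \<gamma>_def
    by (intro smooth_on_diff smooth_on_sum smooth_on_scaleR smooth_on_const smooth_on_frechet_derivative
        G_smooth \<psi>_smooth r_smooth op I finite_Basis)
  then obtain w where w: "smooth_on (cimg c) w" and Sw: "\<And>u. u \<in> cimg c \<Longrightarrow> S u (w u) = h u"
    using smooth_on_linear_solution[OF op S_lin S_inj S_smooth] by metis
  define a where "a U u = \<psi> u * b U + r U u \<bullet> w u" for U u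
  have w0: "w u = 0" if "u \<in> cimg c" "h u = 0" for u
    using S_0[OF that(1)] Sw that by simp
  have DG0: "frechet_derivative G (at u) v = 0" if u: "u \<in> cimg c" "u \<notin> B" for u v
  proof -
    have "(G has_derivative (\<lambda>v. 0)) (at u)"
      by (rule has_derivative_transform_within_open[OF has_derivative_const[of 0] compact_imp_closed[OF B(1), THEN open_Compl]])
        (use u in \<open>auto simp: G_def \<psi>0\<close>)
    from frechet_derivative_at[OF this] show ?thesis by metis
  qed
  have a_supp: "a U u = 0" if u: "u \<in> cimg c" "u \<notin> B" for U u
  proof -
    have "h u = 0" using u by (simp add: h_def \<gamma>_def DG0 \<psi>0)
    then show ?thesis using w0[OF u(1)] u by (simp add: a_def \<psi>0)
  qed
  have a_smooth: "smooth_on (cimg c) (a U)" for U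
    unfolding a_def by (intro smooth_on_add smooth_on_mult smooth_on_inner smooth_on_const r_smooth w \<psi>_smooth op)
  have a_eq: "(\<Sum>U\<in>I. a U u * form_rep A \<Omega> c u (rev U @ [v])) = frechet_derivative G (at u) v"
    if u: "u \<in> cimg c" for u v
  proof -
    have "(\<Sum>U\<in>I. a U u * form_rep A \<Omega> c u (rev U @ [v])) =
        (\<psi> u *\<^sub>R (\<Sum>U\<in>I. b U *\<^sub>R r U u) + S u (w u)) \<bullet> v"
      by (simp add: a_def r[OF u, symmetric] S_def inner_add_left inner_sum_left sum.distrib algebra_simps sum_distrib_left)
    also have "\<dots> = frechet_derivative G (at u) v"
      by (simp add: Sw[OF u] h_def \<gamma>[OF u])
    finally show ?thesis .
  qed
  have a0: "(\<Sum>U\<in>I. a U u0 * F U) = F V + s * F W" for F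
  proof -
    have "((\<lambda>u. (l \<bullet> (u - u0))) has_derivative (\<lambda>v. l \<bullet> v)) (at u0)"
      by (auto intro!: derivative_eq_intros)
    then have "(G has_derivative (\<lambda>v. \<psi> u0 *\<^sub>R (l \<bullet> v))) (at u0)"
      unfolding G_def real_scaleR_def[symmetric]
      by (intro has_derivative_scaleR_vanishing)
        (use smooth_on_continuous_on[OF \<psi>(1)] in \<open>auto simp: continuous_on_eq_continuous_at\<close>)
    from frechet_derivative_at[OF this] have "frechet_derivative G (at u0) v = l \<bullet> v" for v
      using \<psi>(2) by (metis scaleR_one)
    then have "\<gamma> u0 = l" by (simp add: \<gamma>_def euclidean_representation)
    then have "h u0 = 0" using \<psi>(2) by (simp add: h_def l_def)
    then have "a U u0 = b U" for U using w0[OF u0] \<psi>(2) by (simp add: a_def)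
    moreover have "(\<Sum>U\<in>I. b U * F U) =
        (\<Sum>U\<in>I. if U = V then F V else 0) + s * (\<Sum>U\<in>I. if U = W then F W else 0)"
      unfolding sum_distrib_left sum.distrib[symmetric] by (rule sum.cong) (auto simp: b_def algebra_simps)
    moreover have "V \<in> I" "W \<in> I" by (auto simp: I_def)
    ultimately show ?thesis using I by simp
  qed
  have G_supp: "G u = 0" if "u \<notin> B" for u using that by (simp add: G_def \<psi>0)
  have G0: "G u0 = 0" by (simp add: G_def)
  show thesis by (rule that[OF I len B a_smooth a_supp G_smooth G_supp G0 a_eq a0])
qed

lemma locally_hamiltonian_chart_mv:
  assumes c: "c \<in> A" and B: "compact B" "B \<subseteq> cimg c" and I: "finite I" "\<And>V. V \<in> I \<Longrightarrow> length V = m"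
    and a: "\<And>V. V \<in> I \<Longrightarrow> smooth_on (cimg c) (a V)" "\<And>V u. V \<in> I \<Longrightarrow> u \<in> cimg c \<Longrightarrow> u \<notin> B \<Longrightarrow> a V u = 0"
    and G: "smooth_on (cimg c) G" "\<And>u. u \<in> cimg c \<Longrightarrow> u \<notin> B \<Longrightarrow> G u = 0"
    and aG: "\<And>u v. u \<in> cimg c \<Longrightarrow>
      (\<Sum>V\<in>I. a V u * form_rep A \<Omega> c u (rev V @ [v])) = frechet_derivative G (at u) v"
  shows "locally_hamiltonian A \<Omega> m (chart_mv A c I a)"
  unfolding locally_hamiltonian_def
  by (intro conjI multivector_field_chart_mv[OF A c B] closed_form_contract_chart_mv[OF A c B alt_\<Omega> _ G aG] I a)


section \<open>The algebraic condition at a point\<close>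

text \<open>The relation \<open>i(X\<^sub>0)\<Omega> \<and> i(X\<^sub>0)\<alpha> = 0\<close> at \<open>x\<close>, for \<open>X\<^sub>0 = V + s W\<close> with reversed lists: it is the value at \<open>x\<close> of
  \<open>L(GX)\<alpha>\<close>, where \<open>i(X)\<Omega> = dG\<close> and \<open>G\<close> vanishes at \<open>x\<close>. The term \<open>i(GX)d\<alpha>\<close> is zero there, and in
  \<open>d(G i(X)\<alpha>)\<close> only the derivative of \<open>G\<close> survives.\<close>

lemma invariance_pointwise:
  assumes \<alpha>: "diff_form A p \<alpha>"
    and inv: "\<And>X. locally_hamiltonian A \<Omega> m X \<Longrightarrow> \<forall>x vs. lie A m X \<alpha> x vs = 0"
    and V: "length V = m" and W: "length W = m"
  shows "(\<Sum>i<length vs. (- 1) ^ i * ((\<Omega> x (V @ [vs ! i]) + s * \<Omega> x (W @ [vs ! i])) *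
      (\<alpha> x (V @ take i vs @ drop (Suc i) vs) + s * \<alpha> x (W @ take i vs @ drop (Suc i) vs)))) = 0"
proof -
  define c where "c = chart_at A x"
  define u0 where "u0 = coord c x"
  have c: "c \<in> A" and x: "x \<in> cdom c" unfolding c_def by (rule chart_at[OF A])+
  have u0: "u0 \<in> cimg c" using x by (simp add: u0_def)
  note op = chart_open(2)[OF A c]
  have alt_\<alpha>: "alt_form p (\<alpha> y)" for y
    using \<alpha> by (simp add: diff_form_def)
  have \<alpha>_smooth: "smooth_on (cimg c) (\<lambda>u. form_rep A \<alpha> c u ws)" for ws
    using \<alpha> c by (simp add: diff_form_def)
  have rep0: "form_rep A \<omega> c u0 ws = \<omega> x ws" for \<omega> ws
    unfolding u0_def c_def by (rule form_rep_chart_at[OF A])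
  obtain I a G B where I: "finite I" "\<And>U. U \<in> I \<Longrightarrow> length U = m" and B: "compact B" "B \<subseteq> cimg c"
    and a: "\<And>U. U \<in> I \<Longrightarrow> smooth_on (cimg c) (a U)" "\<And>U u. U \<in> I \<Longrightarrow> u \<in> cimg c \<Longrightarrow> u \<notin> B \<Longrightarrow> a U u = 0"
    and G: "smooth_on (cimg c) G" "\<And>u. u \<in> cimg c \<Longrightarrow> u \<notin> B \<Longrightarrow> G u = 0" "G u0 = (0::real)"
    and aG: "\<And>u v. u \<in> cimg c \<Longrightarrow>
      (\<Sum>U\<in>I. a U u * form_rep A \<Omega> c u (rev U @ [v])) = frechet_derivative G (at u) v"
    and a0: "\<And>F. (\<Sum>U\<in>I. a U u0 * F U) = F (rev V) + s * F (rev W)"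
    by (rule hamiltonian_multivector_coefficients[OF c u0, of "rev V" "rev W" s]) (use V W in auto)
  define X where "X = chart_mv A c I (\<lambda>U u. G u * a U u)"
  \<comment> \<open>\<open>i(GX)\<Omega> = G dG = d(G\<^sup>2/2)\<close>\<close>
  have "locally_hamiltonian A \<Omega> m X"
    unfolding X_def
  proof (rule locally_hamiltonian_chart_mv[OF c B I, where G = "\<lambda>u. (1/2) * (G u * G u)"])
    fix u v assume u: "u \<in> cimg c"
    note D = smooth_on_has_derivative[OF G(1) u]
    have "((\<lambda>u. (1/2) * (G u * G u)) has_derivative (\<lambda>v. G u * frechet_derivative G (at u) v)) (at u)"
      by (auto intro!: derivative_eq_intros D)
    from fun_cong[OF frechet_derivative_at[OF this], of v]
    show "(\<Sum>V\<in>I. G u * a V u * form_rep A \<Omega> c u (rev V @ [v])) =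
        frechet_derivative (\<lambda>u. (1/2) * (G u * G u)) (at u) v"
      by (simp add: aG[OF u, symmetric] sum_distrib_left mult.assoc)
  next
    show "smooth_on (cimg c) (\<lambda>u. (1/2) * (G u * G u))"
      by (intro smooth_on_mult smooth_on_const op G)
  qed (use a G in \<open>auto intro: smooth_on_mult op\<close>)
  with inv have lie0: "lie A m X \<alpha> x vs = 0" by blast
  have "X x \<omega> = 0" for \<omega>
    using x G(3) by (simp add: X_def chart_mv_def u0_def)
  then have "contract_field X (ext_deriv A \<alpha>) x vs = 0"
    by (simp add: contract_field_def contract_def)
  with lie0 have d0: "ext_deriv A (contract_field X \<alpha>) x vs = 0" by (simp add: lie_def)
  have "frechet_derivative (\<lambda>u. form_rep A (contract_field X \<alpha>) c u ws) (at u0) v =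
      (\<Omega> x (V @ [v]) + s * \<Omega> x (W @ [v])) * (\<alpha> x (V @ ws) + s * \<alpha> x (W @ ws))" for ws v
  proof -
    define Q where "Q u = (\<Sum>U\<in>I. a U u * form_rep A \<alpha> c u (rev U @ ws))" for u
    have "smooth_on (cimg c) Q"
      unfolding Q_def by (intro smooth_on_sum smooth_on_mult a \<alpha>_smooth op I)
    then have "isCont Q u0"
      using smooth_on_continuous_on op u0 by (metis continuous_on_eq_continuous_at)
    then have "((\<lambda>u. Q u *\<^sub>R G u) has_derivative (\<lambda>v. Q u0 *\<^sub>R frechet_derivative G (at u0) v)) (at u0)"
      by (intro has_derivative_scaleR_vanishing smooth_on_has_derivative[OF G(1) u0] G(3))
    then have "((\<lambda>u. form_rep A (contract_field X \<alpha>) c u ws) has_derivative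
        (\<lambda>v. Q u0 *\<^sub>R frechet_derivative G (at u0) v)) (at u0)"
    proof (rule has_derivative_transform_within_open[OF _ op u0])
      fix u assume u: "u \<in> cimg c"
      show "Q u *\<^sub>R G u = form_rep A (contract_field X \<alpha>) c u ws"
        using form_rep_contract_chart_mv[where \<omega> = \<alpha>, OF A c c alt_\<alpha> cinv_in[OF A c u], of I "\<lambda>U u. G u * a U u" ws]
          cinv_in[OF A c u]
        by (simp add: X_def coord_cinv[OF A c u] tchange_self[OF A c] map_idI Q_def sum_distrib_left algebra_simps)
    qed
    from fun_cong[OF frechet_derivative_at[OF this, symmetric], of v] show ?thesis
      by (simp add: Q_def a0 aG[OF u0, symmetric] rep0 mult.commute)
  qed
  with d0 show ?thesis
    by (simp add: ext_deriv_def c_def[symmetric] u0_def[symmetric])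
qed

lemma multisymplectic_nonzero: obtains V w where "length V = m" "\<Omega> x (V @ [w]) \<noteq> 0"
  using multisymplectic_nondegenerate_last[of x "SOME b. b \<in> Basis"] nonzero_Basis SOME_Basis by blast

lemma invariant_form_eq_0:
  assumes \<alpha>: "diff_form A m \<alpha>"
    and inv: "\<And>X. locally_hamiltonian A \<Omega> m X \<Longrightarrow> \<forall>x vs. lie A m X \<alpha> x vs = 0"
  shows "\<alpha> x vs = 0"
proof -
  obtain V w where V: "length V = m" "\<Omega> x (V @ [w]) \<noteq> 0" by (rule multisymplectic_nonzero)
  have alt_\<alpha>: "alt_form m (\<alpha> x)" using \<alpha> by (simp add: diff_form_def)
  show ?thesis
  proof (rule alt_form_eq_0_of_product[OF alt_\<Omega> alt_\<alpha> _ V])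
    fix P Q :: "'e list" and s z assume "length P = m" "length Q = m"
    from invariance_pointwise[OF \<alpha> inv this, where vs = "[z]" and x = x and s = s]
    show "(\<Omega> x (P @ [z]) + s * \<Omega> x (Q @ [z])) * (\<alpha> x P + s * \<alpha> x Q) = 0" by simp
  qed
qed

lemma invariant_form_proportional:
  assumes \<alpha>: "diff_form A (Suc m) \<alpha>"
    and inv: "\<And>X. locally_hamiltonian A \<Omega> m X \<Longrightarrow> \<forall>x vs. lie A m X \<alpha> x vs = 0"
  obtains h where "\<And>x vs. \<alpha> x vs = h x * \<Omega> x vs"
proof -
  have "\<exists>c. \<forall>vs. \<alpha> x vs = c * \<Omega> x vs" for x
  proof -
    obtain V w where V: "length V = m" "\<Omega> x (V @ [w]) \<noteq> 0" by (rule multisymplectic_nonzero)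
    have alt_\<alpha>: "alt_form (Suc m) (\<alpha> x)" using \<alpha> by (simp add: diff_form_def)
    have "\<alpha> x vs = \<alpha> x (V @ [w]) / \<Omega> x (V @ [w]) * \<Omega> x vs" for vs
    proof (rule alt_form_proportional[OF alt_\<Omega> alt_\<alpha> m_nz _ V])
      fix P Q :: "'e list" and s z1 z2 assume "length P = m" "length Q = m"
      from invariance_pointwise[OF \<alpha> inv this, where vs = "[z1, z2]" and x = x and s = s]
      show "(\<Omega> x (P @ [z1]) + s * \<Omega> x (Q @ [z1])) * (\<alpha> x (P @ [z2]) + s * \<alpha> x (Q @ [z2])) =
          (\<Omega> x (P @ [z2]) + s * \<Omega> x (Q @ [z2])) * (\<alpha> x (P @ [z1]) + s * \<alpha> x (Q @ [z1]))"
        by (simp add: numeral_2_eq_2)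
    qed
    then show ?thesis by blast
  qed
  then show thesis using that by metis
qed

section \<open>The factor is constant\<close>

text \<open>The Lie derivative of \<open>h\<Omega>\<close> along a field \<open>X\<close> with \<open>i(X)\<Omega> = dG\<close> and value \<open>e \<and> U\<close> at \<open>x\<close> (up to the order of
  the factors) is evaluated on \<open>w, e\<close>. Because \<open>e\<close> is repeated, all terms of \<open>dh \<and> \<Omega>\<close> vanish except those in which
  \<open>dh\<close> takes one of the two occurrences of \<open>e\<close>. One of them cancels against \<open>d(h dG) = dh \<and> dG\<close>, the other
  is \<open>dh(e) \<Omega>(U, w, e)\<close> up to sign. As \<open>U\<close> and \<open>w\<close> are arbitrary, \<open>dh(e) \<noteq> 0\<close> would make \<open>e\<close> degenerate.\<close>

lemma invariant_multiple_derivative_0: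
  assumes \<alpha>: "diff_form A (Suc m) \<alpha>"
    and inv: "\<And>X. locally_hamiltonian A \<Omega> m X \<Longrightarrow> \<forall>x vs. lie A m X \<alpha> x vs = 0"
    and h: "\<And>x vs. \<alpha> x vs = h x * \<Omega> x vs"
  shows "((\<lambda>u. h (cinv (chart_at A x) u)) has_derivative (\<lambda>v. 0)) (at (coord (chart_at A x) x))"
proof -
  define c where "c = chart_at A x"
  define u0 where "u0 = coord c x"
  define H where "H u = h (cinv c u)" for u
  have c: "c \<in> A" and x: "x \<in> cdom c" unfolding c_def by (rule chart_at[OF A])+
  have u0: "u0 \<in> cimg c" using x by (simp add: u0_def)
  note op = chart_open(2)[OF A c]
  have \<alpha>_smooth: "smooth_on (cimg c) (\<lambda>u. form_rep A \<alpha> c u ws)" for ws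
    using \<alpha> c by (auto simp: diff_form_def)
  have rep0: "form_rep A \<omega> c u0 ws = \<omega> x ws" for \<omega> ws
    unfolding u0_def c_def by (rule form_rep_chart_at[OF A])
  have rep\<alpha>: "form_rep A \<alpha> c u ws = H u * form_rep A \<Omega> c u ws" for u ws
    by (simp add: form_rep_def Let_def h H_def)
  note D\<Omega> = smooth_on_has_derivative[OF smooth_\<Omega>[OF c] u0]
  \<comment> \<open>near \<open>x\<close>, \<open>h\<close> is a quotient of coefficients of \<open>\<alpha>\<close> and \<open>\<Omega>\<close>, hence differentiable\<close>
  obtain H' where H': "(H has_derivative H') (at u0)"
  proof -
    obtain V w where "\<Omega> x (V @ [w]) \<noteq> 0" by (rule multisymplectic_nonzero)
    then have nz: "form_rep A \<Omega> c u0 (V @ [w]) \<noteq> 0" by (simp add: rep0)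
    let ?T = "cimg c \<inter> (\<lambda>u. form_rep A \<Omega> c u (V @ [w])) -` (- {0})"
    have T: "open ?T"
      by (rule continuous_open_preimage[OF smooth_on_continuous_on[OF smooth_\<Omega>[OF c]] op]) auto
    have "(\<lambda>u. form_rep A \<alpha> c u (V @ [w]) / form_rep A \<Omega> c u (V @ [w])) differentiable at u0"
      using smooth_on_has_derivative[OF \<alpha>_smooth u0] D\<Omega> nz
      by (intro differentiable_divide) (auto simp: differentiable_def)
    then obtain H' where "((\<lambda>u. form_rep A \<alpha> c u (V @ [w]) / form_rep A \<Omega> c u (V @ [w])) has_derivative H') (at u0)"
      by (auto simp: differentiable_def)
    then have "(H has_derivative H') (at u0)"
      by (rule has_derivative_transform_within_open[OF _ T]) (use u0 nz in \<open>auto simp: rep\<alpha>\<close>)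
    then show thesis by (rule that)
  qed
  have d\<alpha>: "ext_deriv A \<alpha> x vs = (\<Sum>i<length vs. (- 1) ^ i * (H' (vs ! i) * \<Omega> x (take i vs @ drop (Suc i) vs)))" for vs
  proof -
    have "frechet_derivative (\<lambda>u. form_rep A \<alpha> c u ws) (at u0) v =
        H u0 * frechet_derivative (\<lambda>u. form_rep A \<Omega> c u ws) (at u0) v + H' v * \<Omega> x ws" for ws v
    proof -
      have "((\<lambda>u. form_rep A \<alpha> c u ws) has_derivative
        (\<lambda>v. H u0 * frechet_derivative (\<lambda>u. form_rep A \<Omega> c u ws) (at u0) v + H' v * form_rep A \<Omega> c u0 ws)) (at u0)"
        unfolding rep\<alpha> by (rule has_derivative_mult[OF H' D\<Omega>])
      from fun_cong[OF frechet_derivative_at[OF this], of v] show ?thesis by (simp add: rep0)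
    qed
    then have "ext_deriv A \<alpha> x vs = H u0 * ext_deriv A \<Omega> x vs +
        (\<Sum>i<length vs. (- 1) ^ i * (H' (vs ! i) * \<Omega> x (take i vs @ drop (Suc i) vs)))"
      by (simp add: ext_deriv_def c_def[symmetric] u0_def[symmetric] sum_distrib_left sum.distrib[symmetric] algebra_simps)
    then show ?thesis using closed_\<Omega> by (simp add: closed_form_def)
  qed
  have H'_lin: "linear H'" by (rule has_derivative_linear[OF H'])
  have alt_d\<alpha>: "alt_form (Suc (Suc m)) (ext_deriv A \<alpha> x)"
  proof -
    have "alt_form (Suc m) (\<lambda>ws. H' v * \<Omega> x ws)" for v
      using alt_\<Omega>[of x] unfolding alt_form_def
      by (auto intro: linear_compose_scale_right[where 'b = real, unfolded real_scaleR_def])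
    moreover have "linear (\<lambda>v. H' v * \<Omega> x ws)" for ws
      using linear_compose_scale_right[where 'b = real, unfolded real_scaleR_def, OF H'_lin, of "\<Omega> x ws"]
      by (simp add: mult.commute)
    ultimately have "alt_form (Suc (Suc m))
        (\<lambda>vs. \<Sum>i<length vs. (- 1) ^ i * (H' (vs ! i) * \<Omega> x (take i vs @ drop (Suc i) vs)))"
      by (rule alt_form_antisymmetrise)
    then show ?thesis by (simp add: d\<alpha>[abs_def])
  qed
  have main: "H' e * \<Omega> x (U @ [w, e]) = 0" if U: "Suc (length U) = m" for e U w
  proof -
    obtain I a G B where I: "finite I" "\<And>U. U \<in> I \<Longrightarrow> length U = m" and B: "compact B" "B \<subseteq> cimg c"
      and a: "\<And>U. U \<in> I \<Longrightarrow> smooth_on (cimg c) (a U)" "\<And>U u. U \<in> I \<Longrightarrow> u \<in> cimg c \<Longrightarrow> u \<notin> B \<Longrightarrow> a U u = 0"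
      and G: "smooth_on (cimg c) G" "\<And>u. u \<in> cimg c \<Longrightarrow> u \<notin> B \<Longrightarrow> G u = 0" "G u0 = (0::real)"
      and aG: "\<And>u v. u \<in> cimg c \<Longrightarrow>
        (\<Sum>U\<in>I. a U u * form_rep A \<Omega> c u (rev U @ [v])) = frechet_derivative G (at u) v"
      and a0: "\<And>F. (\<Sum>U\<in>I. a U u0 * F U) = F (rev (e # U)) + 0 * F (rev (e # U))"
      by (rule hamiltonian_multivector_coefficients[OF c u0, of "rev (e # U)" "rev (e # U)" 0]) (use U in auto)
    define X where "X = chart_mv A c I a"
    have "locally_hamiltonian A \<Omega> m X"
      unfolding X_def by (rule locally_hamiltonian_chart_mv[OF c B I a G(1,2) aG])
    with inv have lie0: "lie A m X \<alpha> x [w, e] = 0" by blast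
    have DG: "frechet_derivative G (at u0) v = \<Omega> x (e # U @ [v])" for v
      using aG[OF u0, of v, symmetric] by (simp add: a0 rep0)
    have "frechet_derivative (\<lambda>u. form_rep A (contract_field X \<alpha>) c u [z]) (at u0) v =
        H u0 * frechet_derivative (\<lambda>u. frechet_derivative G (at u) z) (at u0) v + H' v * \<Omega> x (e # U @ [z])" for z v
    proof -
      have "((\<lambda>u. H u * frechet_derivative G (at u) z) has_derivative
          (\<lambda>v. H u0 * frechet_derivative (\<lambda>u. frechet_derivative G (at u) z) (at u0) v +
            H' v * frechet_derivative G (at u0) z)) (at u0)"
        by (rule has_derivative_mult[OF H' smooth_on_has_derivative[OF smooth_on_frechet_derivative[OF G(1)] u0]])
      then have "((\<lambda>u. form_rep A (contract_field X \<alpha>) c u [z]) has_derivative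
          (\<lambda>v. H u0 * frechet_derivative (\<lambda>u. frechet_derivative G (at u) z) (at u0) v +
            H' v * frechet_derivative G (at u0) z)) (at u0)"
      proof (rule has_derivative_transform_within_open[OF _ op u0])
        fix u assume u: "u \<in> cimg c"
        have "alt_form (Suc m) (\<alpha> y)" for y using \<alpha> by (simp add: diff_form_def)
        from form_rep_contract_chart_mv[where \<omega> = \<alpha>, OF A c c this cinv_in[OF A c u], of I a "[z]"] cinv_in[OF A c u]
        show "H u * frechet_derivative G (at u) z = form_rep A (contract_field X \<alpha>) c u [z]"
          by (simp add: X_def coord_cinv[OF A c u] tchange_self[OF A c] rep\<alpha> aG[OF u, symmetric] sum_distrib_left algebra_simps)
      qed
      from fun_cong[OF frechet_derivative_at[OF this], of v] show ?thesis by (simp add: DG)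
    qed
    then have "ext_deriv A (contract_field X \<alpha>) x [w, e] =
        H' w * \<Omega> x (e # U @ [e]) - H' e * \<Omega> x (e # U @ [w])"
      using second_derivative_symmetric[OF op G(1) u0, of e w]
      by (simp add: ext_deriv_def c_def[symmetric] u0_def[symmetric] numeral_2_eq_2 algebra_simps)
    moreover have "\<Omega> x (e # zs @ [e]) = 0" for zs
      using alt_form_repeat[OF alt_\<Omega>, of x "[]" e zs "[]"] by simp
    ultimately have 1: "ext_deriv A (contract_field X \<alpha>) x [w, e] = - H' e * \<Omega> x (e # U @ [w])" by simp
    have "contract_field X (ext_deriv A \<alpha>) x [w, e] = ext_deriv A \<alpha> x (e # U @ [w, e])"
    proof -
      have "X x = (\<lambda>\<omega>. \<Sum>U\<in>I. a U u0 * wedge U \<omega>)"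
        using x by (simp add: X_def chart_mv_def c_def[symmetric] tchange_self[OF A c] map_idI u0_def)
      then have "contract_field X (ext_deriv A \<alpha>) x [w, e] =
          (\<Sum>U\<in>I. a U u0 * ext_deriv A \<alpha> x (rev U @ [w, e]))"
        by (simp only: contract_field_def contract_sum_wedge[OF alt_d\<alpha>, where I = I and a = "\<lambda>U. a U u0" and g = "\<lambda>U. U"])
      then show ?thesis by (simp add: a0)
    qed
    also have "\<dots> = H' e * \<Omega> x (U @ [w, e]) + (- 1) ^ Suc m * (H' e * \<Omega> x (e # U @ [w]))"
    proof -
      have "ext_deriv A \<alpha> x (e # U @ [w, e]) =
          (\<Sum>i<Suc (Suc m). (- 1) ^ i * (H' ((e # U @ [w, e]) ! i) *
            \<Omega> x (take i (e # U @ [w, e]) @ drop (Suc i) (e # U @ [w, e]))))"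
        using U by (simp add: d\<alpha>)
      also have "\<dots> = H' e * \<Omega> x (U @ [w, e]) + (\<Sum>i<m. (- 1) ^ Suc i * (H' ((e # U @ [w, e]) ! Suc i) *
            \<Omega> x (take (Suc i) (e # U @ [w, e]) @ drop (Suc (Suc i)) (e # U @ [w, e])))) +
          (- 1) ^ Suc m * (H' e * \<Omega> x (e # U @ [w]))"
        unfolding sum.lessThan_Suc[of _ "Suc m"] sum.lessThan_Suc_shift[of _ m]
        by (simp add: U[symmetric] nth_append)
      also have "(\<Sum>i<m. (- 1) ^ Suc i * (H' ((e # U @ [w, e]) ! Suc i) *
            \<Omega> x (take (Suc i) (e # U @ [w, e]) @ drop (Suc (Suc i)) (e # U @ [w, e])))) = 0"
      proof (rule sum.neutral, rule ballI)
        fix i assume "i \<in> {..<m}"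
        then have "take (Suc i) (e # U @ [w, e]) @ drop (Suc (Suc i)) (e # U @ [w, e]) =
            e # (take i (U @ [w]) @ drop (Suc i) (U @ [w])) @ [e]"
          using U by (auto simp: less_Suc_eq)
        then show "(- 1) ^ Suc i * (H' ((e # U @ [w, e]) ! Suc i) *
            \<Omega> x (take (Suc i) (e # U @ [w, e]) @ drop (Suc (Suc i)) (e # U @ [w, e]))) = 0"
          by (simp only: \<open>\<And>zs. \<Omega> x (e # zs @ [e]) = 0\<close> mult_zero_right)
      qed
      finally show ?thesis by simp
    qed
    finally have 2: "contract_field X (ext_deriv A \<alpha>) x [w, e] =
        H' e * \<Omega> x (U @ [w, e]) - (- 1) ^ m * (H' e * \<Omega> x (e # U @ [w]))" by simp
    \<comment> \<open>the two copies of \<open>dh(e) \<Omega>(e, U, w)\<close> in the Lie derivative cancel by this sign identity\<close>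
    have "(- 1 :: real) ^ m * (- 1) ^ m = 1" by (simp flip: power_mult_distrib)
    then have "(- 1) ^ m * (H' e * \<Omega> x (U @ [w, e])) = 0"
      using lie0 by (simp add: lie_def 1 2 right_diff_distrib flip: mult.assoc)
    then show ?thesis by simp
  qed
  have "H' e = 0" for e
  proof (rule ccontr)
    assume nz: "H' e \<noteq> 0"
    have "e = 0"
    proof (rule multisymplectic_nondegenerate_last[of x])
      fix P :: "'e list" assume "length P = m"
      then obtain U w where "P = U @ [w]" "Suc (length U) = m"
        using m_nz by (cases P rule: rev_cases) auto
      then show "\<Omega> x (P @ [e]) = 0" using main[of U e w] nz by simp
    qed
    then show False using nz linear_0[OF H'_lin] by simp
  qed
  then have "H' = (\<lambda>v. 0)" by blast
  then show ?thesis using H' by (simp add: H_def[abs_def] c_def u0_def)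
qed

text \<open>The derivative is assumed to vanish only at the centre of each reference chart; the transition maps transport this to
  all points of a single chart, where \<open>h\<close> is then locally constant.\<close>

lemma constant_of_derivative_0:
  fixes h :: "'m \<Rightarrow> real"
  assumes conn: "connected (UNIV :: 'm set)"
    and D: "\<And>x. ((\<lambda>u. h (cinv (chart_at A x) u)) has_derivative (\<lambda>v. 0)) (at (coord (chart_at A x) x))"
  shows "h x = h y"
proof (rule connected_local_const[OF conn UNIV_I UNIV_I], rule ballI)
  fix x :: 'm
  define c where "c = chart_at A x"
  have c: "c \<in> A" and x: "x \<in> cdom c" unfolding c_def by (rule chart_at[OF A])+
  have Dc: "((\<lambda>u. h (cinv c u)) has_derivative (\<lambda>v. 0)) (at u)" if u: "u \<in> cimg c" for u
  proof -
    define y where "y = cinv c u"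
    have y: "y \<in> cdom c" "u = coord c y"
      unfolding y_def using cinv_in[OF A c u] coord_cinv[OF A c u] by auto
    define c' where "c' = chart_at A y"
    have c': "c' \<in> A" and y': "y \<in> cdom c'" unfolding c'_def by (rule chart_at[OF A])+
    have "((\<lambda>u. h (cinv c' (coord c' (cinv c u)))) has_derivative (\<lambda>v. 0)) (at (coord c y))"
      by (rule has_derivative_compose[OF tchange_has_derivative[OF A c c' y(1) y']])
        (use D[of y] y in \<open>simp add: c'_def cinv_coord[OF A c]\<close>)
    then have "((\<lambda>u. h (cinv c u)) has_derivative (\<lambda>v. 0)) (at (coord c y))"
      by (rule has_derivative_transform_within_open[OF _ open_coord_image[OF A c chart_open(1)[OF A c']]])
        (use y y' in \<open>auto simp: cinv_coord[OF A c] cinv_coord[OF A c']\<close>)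
    then show ?thesis using y by simp
  qed
  obtain r where r: "r > 0" "ball (coord c x) r \<subseteq> cimg c"
    using chart_open(2)[OF A c] x by (meson imageI openE)
  have "\<exists>k. \<forall>u\<in>ball (coord c x) r. h (cinv c u) = k"
    by (rule has_derivative_zero_constant[OF convex_ball]) (use r in \<open>blast intro: has_derivative_at_withinI Dc\<close>)
  then have const: "h (cinv c u) = h x" if "u \<in> ball (coord c x) r" for u
    using that r(1) cinv_coord[OF A c x] by (metis centre_in_ball)
  have "open (cdom c \<inter> coord c -` ball (coord c x) r)"
    by (rule continuous_open_preimage[OF _ chart_open(1)[OF A c] open_ball])
      (use A c in \<open>auto simp: smooth_atlas_def is_chart_def homeomorphism_def\<close>)
  moreover have "h z = h x" if "z \<in> cdom c \<inter> coord c -` ball (coord c x) r" for z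
    using const[of "coord c z"] that cinv_coord[OF A c] by simp
  ultimately show "\<forall>\<^sub>F z in at x within UNIV. h x = h z"
    using x r(1) unfolding eventually_at_topological
    by (metis (no_types, lifting) IntI centre_in_ball vimageI2)
qed

end

theorem theorem5p3:
  fixes A :: "('m::t2_space, 'e::euclidean_space) chart set"
    and \<Omega> \<alpha> :: "'m \<Rightarrow> 'e list \<Rightarrow> real"
    and k p :: nat
  assumes "manifold A"
    and "multisymplectic A k \<Omega>"
    and "locally_homogeneous A \<Omega>"
    and "p = k - 1 \<or> p = k"
    and "diff_form A p \<alpha>"
    and "\<And>X. locally_hamiltonian A \<Omega> (k - 1) X \<Longrightarrow> \<forall>x vs. lie A (k - 1) X \<alpha> x vs = 0"
    and "\<And>Z. locally_hamiltonian_vf A \<Omega> Z \<Longrightarrow> \<forall>x vs. lie A 1 (mv_of_vf Z) \<alpha> x vs = 0"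
  shows "(p = k \<longrightarrow> (\<exists>c::real. \<forall>x vs. \<alpha> x vs = c * \<Omega> x vs)) \<and>
         (p = k - 1 \<longrightarrow> (\<forall>x vs. \<alpha> x vs = 0))"
proof (intro conjI impI)
  have A: "smooth_atlas A" and conn: "connected (UNIV :: 'm set)"
    using assms(1) by (auto simp: manifold_def)
  obtain m where k: "k = Suc m" using assms(2) by (cases k) (auto simp: multisymplectic_def)
  note \<Omega> = assms(2)[unfolded k]
  have inv: "\<And>X. locally_hamiltonian A \<Omega> m X \<Longrightarrow> \<forall>x vs. lie A m X \<alpha> x vs = 0"
    using assms(6) by (simp add: k)
  show "\<forall>x vs. \<alpha> x vs = 0" if "p = k - 1"
  proof (intro allI)
    have "diff_form A m \<alpha>" using assms(5) that k by simp
    then show "\<alpha> x vs = 0" for x vs by (rule invariant_form_eq_0[OF A \<Omega> _ inv])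
  qed
  show "\<exists>c::real. \<forall>x vs. \<alpha> x vs = c * \<Omega> x vs" if "p = k"
  proof -
    have \<alpha>: "diff_form A (Suc m) \<alpha>" using assms(5) that k by simp
    obtain h where h: "\<And>x vs. \<alpha> x vs = h x * \<Omega> x vs"
      using invariant_form_proportional[OF A \<Omega> \<alpha> inv] by blast
    have "h x = h y" for x y
      by (rule constant_of_derivative_0[OF A \<Omega> conn invariant_multiple_derivative_0[OF A \<Omega> \<alpha> inv h]])
    then have "\<alpha> x vs = h undefined * \<Omega> x vs" for x vs using h by metis
    then show ?thesis by blast
  qed
qed

end
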